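(* Let $N \cong \mathbb{Z}^2$ be a lattice of rank $2$ with dual lattice $M$, and let $\Delta \subseteq N_{\mathbb{R}}$ be an LDP polygon. Then $$12 \sum_{n \in \Delta \cap N} \left( \kappa_{\Delta}(n) + 1 \right)^2 = v(\Delta) + v(\Delta^* ),$$ where $\kappa_\Delta \colon N_{\mathbb{R}} \to \mathbb{R}$, $x \mapsto -\min\{\lambda \in \mathbb{R}_{\geq 0} \mid x \in \lambda\Delta\}$. In particular, one always has $v(\Delta) + v(\Delta^* ) \geq 12$, and equality holds if and only if $\Delta$ is reflexive.
   Context: Let $N$ be a free abelian group of rank $2$, $M = \mathrm{Hom}(N,\mathbb{Z})$ its dual lattice, $N_{\mathbb{R}} = N \otimes_{\mathbb{Z}} \mathbb{R}$, $M_{\mathbb{R}} = M \otimes_{\mathbb{Z}} \mathbb{R}$, and $\langle\cdot,\cdot\rangle \colon M_{\mathbb{R}} \times N_{\mathbb{R}} \to \mathbb{R}$ the natural pairing. A polygon is a $2$-dimensional polytope (convex hull of a finite set). A lattice polygon in $N_{\mathbb{R}}$ is a polygon all of whose vertices lie in $N$ (similarly for $M$). An LDP polygon is a lattice polygon $\Delta \subseteq N_{\mathbb{R}}$ containing the origin in its interior and such that all vertices of $\Delta$ are primitive lattice points of $N$. The dual polygon is $\Delta^* = \{y \in M_{\mathbb{R}} \mid \langle y,x\rangle \geq -1 \text{ for all } x \in \Delta\}$; it is a polygon with rational vertices. $\Delta$ is called reflexive if it is a lattice polygon containing the origin in its interior and $\Delta^*$ is a lattice polygon with respect to $M$. The normalized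 volume $v(P)$ of a (rational) polygon $P$ in $N_{\mathbb{R}}$ (resp. $M_{\mathbb{R}}$) is $2$ times its area, where area is normalized so that a fundamental parallelogram of $N$ (resp. $M$) has area $1$. *)

theory Defs
  imports "HOL-Analysis.Analysis"
begin

text \<open>
  The real plane \<open>real^2\<close> plays the role of \<open>N\<^sub>R\<close> with \<open>N\<close> an arbitrary rank-2 lattice in it.
  The inner product identifies \<open>M\<^sub>R\<close> with \<open>real^2\<close> as well, so the natural pairing becomes \<open>\<bullet>\<close>
  and \<open>M = Hom(N, Z)\<close> becomes the lattice of those \<open>y\<close> that are integral on \<open>N\<close>.
\<close>

definition lattice_basis :: "(real^2) set \<Rightarrow> real^2 \<Rightarrow> real^2 \<Rightarrow> bool" where
  "lattice_basis L u v \<longleftrightarrow> u \<noteq> v \<and> independent {u, v} \<and>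
     L = {of_int a *\<^sub>R u + of_int b *\<^sub>R v | a b :: int. True}"

definition rank2_lattice :: "(real^2) set \<Rightarrow> bool" where
  "rank2_lattice L \<longleftrightarrow> (\<exists>u v. lattice_basis L u v)"

definition dual_lattice :: "(real^2) set \<Rightarrow> (real^2) set" where
  "dual_lattice L = {y. \<forall>x\<in>L. y \<bullet> x \<in> \<int>}"

definition primitive_point :: "(real^2) set \<Rightarrow> real^2 \<Rightarrow> bool" where
  "primitive_point L x \<longleftrightarrow> x \<in> L \<and> x \<noteq> 0 \<and>
     (\<forall>y\<in>L. \<forall>k::int. x = of_int k *\<^sub>R y \<longrightarrow> \<bar>k\<bar> = 1)"

definition fundamental_parallelogram :: "real^2 \<Rightarrow> real^2 \<Rightarrow> (real^2) set" where
  "fundamental_parallelogram u v = {s *\<^sub>R u + t *\<^sub>R v | s t. s \<in> {0..1} \<and> t \<in> {0..1}}"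

text \<open>The area of a fundamental parallelogram does not depend on the chosen lattice basis.\<close>

definition covolume :: "(real^2) set \<Rightarrow> real" where
  "covolume L = (THE c. \<exists>u v. lattice_basis L u v \<and>
     c = measure lebesgue (fundamental_parallelogram u v))"

definition normalized_volume :: "(real^2) set \<Rightarrow> (real^2) set \<Rightarrow> real" where
  "normalized_volume L P = 2 * (measure lebesgue P / covolume L)"

definition polygon :: "(real^2) set \<Rightarrow> bool" where
  "polygon P \<longleftrightarrow> polytope P \<and> aff_dim P = 2"

definition vertices :: "(real^2) set \<Rightarrow> (real^2) set" where
  "vertices P = {x. x extreme_point_of P}"

definition lattice_polygon :: "(real^2) set \<Rightarrow> (real^2) set \<Rightarrow> bool" where
  "lattice_polygon L P \<longleftrightarrow> polygon P \<and> vertices P \<subseteq> L"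

definition LDP_polygon :: "(real^2) set \<Rightarrow> (real^2) set \<Rightarrow> bool" where
  "LDP_polygon N \<Delta> \<longleftrightarrow> lattice_polygon N \<Delta> \<and> 0 \<in> interior \<Delta> \<and>
     (\<forall>x\<in>vertices \<Delta>. primitive_point N x)"

definition dual_polygon :: "(real^2) set \<Rightarrow> (real^2) set" where
  "dual_polygon \<Delta> = {y. \<forall>x\<in>\<Delta>. y \<bullet> x \<ge> -1}"

definition reflexive_polygon :: "(real^2) set \<Rightarrow> (real^2) set \<Rightarrow> bool" where
  "reflexive_polygon N \<Delta> \<longleftrightarrow> lattice_polygon N \<Delta> \<and> 0 \<in> interior \<Delta> \<and>
     lattice_polygon (dual_lattice N) (dual_polygon \<Delta>)"

definition kappa :: "(real^2) set \<Rightarrow> real^2 \<Rightarrow> real" where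
  "kappa \<Delta> x = - (LEAST c::real. c \<ge> 0 \<and> x \<in> (*\<^sub>R) c ` \<Delta>)"

end

(*
  Idea of the proof.  Let v run through the vertices of the polygon in counterclockwise order, w being the
  successor of v and d = det (v, w).  Lattice points on the boundary contribute 0 and the origin contributes 1; the
  lattice points inside the triangle 0, v, w contribute (d-1)(d-2)/(12d) + s(v, w), where s(v, w) is the Dedekind
  sum of the cone spanned by v and w.  Both volumes are sums over the vertices as well, so the identity reduces to
  a formula for the sum of all s(v, w).  That formula follows from Rademacher's three-term law for Dedekind sums,
  applied to v, w and a fixed primitive vector e that is parallel to no vertex: in the sum over all v the terms
  s(w, e) - s(v, e) telescope, and the constant 12 appears because det (e, v) changes its sign exactly twice.
  The origin alone contributes 12, so equality means that every other lattice point of the polygon has kappa = -1,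
  that is, that the linear function with value 1 on v and w is integral for every edge.
*)

theory Submission
  imports Defs
begin

text \<open>The bookkeeping behind the reduction, for an edge with determinant \<open>d\<close>
  whose ends have determinants \<open>q\<close> and \<open>q'\<close> with \<open>e\<close>: twelve
  times the triangle sum is \<open>d - 3 + 2/d\<close> plus twelve Dedekind sums. The law replaces
  the latter by \<open>3 * sgn (q * q')\<close>, minus \<open>d / (q * q')\<close>, minus
  \<open>(q^2 + q'^2) / (d * q * q')\<close>, plus terms in \<open>e\<close>. The middle fraction is
  a difference of slopes and telescopes as well. The last one does not, but exactly the same sum is
  hidden in the dual area. The signs add up to the number of edges minus 4, so three times their sum
  removes both the \<open>-3\<close> of every edge and the 12 of the origin. The obstacle is that
  \<open>e\<close> sees edges in both orientations. Hence Dedekind sums of cones carry a sign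
  (\<open>dpair\<close>), and the law has to hold for every sign pattern. On the convex side no
  angles occur: the cone over an edge is the region where one of finitely many linear functions
  \<open>ht v\<close> is maximal, and the successor is a permutation of the vertices, so that
  telescoping is the reindexing of a sum.\<close>

section \<open>Dedekind sums\<close>

text \<open>The sawtooth is written as \<open>x - 1/2\<close>, without its usual value 0 at
  integers: for coprime \<open>h\<close> and \<open>k\<close> no argument that occurs is an integer,
  and the sum is the classical s(h, k). For \<open>k <= 1\<close> the range is empty.\<close>

definition dsum :: "int \<Rightarrow> int \<Rightarrow> real" where
  "dsum h k = (\<Sum>j\<in>{1..<k}. (of_int j / of_int k - 1/2) * (of_int (h * j mod k) / of_int k - 1/2))"

lemma dsum_1 [simp]: "dsum h 1 = 0"
  by (simp add: dsum_def)

lemma dsum_cong_mod: "h mod k = h' mod k \<Longrightarrow> dsum h k = dsum h' k"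
  unfolding dsum_def by (intro sum.cong refl) (metis mod_mult_cong)

lemma mult_mod_pos:
  fixes h k j :: int
  assumes "coprime h k" "j \<in> {1..<k}"
  shows "h * j mod k \<in> {1..<k}"
proof -
  have "\<not> k dvd h * j"
    using assms by (metis atLeastLessThan_iff coprime_commute coprime_dvd_mult_right_iff
        less_le_trans not_le zdvd_imp_le zero_less_one)
  then have "h * j mod k \<noteq> 0" by (simp add: dvd_eq_mod_eq_0)
  moreover have "0 \<le> h * j mod k" "h * j mod k < k" using assms by auto
  ultimately show ?thesis by auto
qed

lemma bij_betw_mult_mod:
  fixes h k :: int
  assumes "coprime h k"
  shows "bij_betw (\<lambda>j. h * j mod k) {1..<k} {1..<k}"
proof -
  have inj: "inj_on (\<lambda>j. h * j mod k) {1..<k}"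
  proof (rule inj_onI)
    fix i j assume ij: "i \<in> {1..<k}" "j \<in> {1..<k}" "h * i mod k = h * j mod k"
    then have "k dvd h * (i - j)" by (simp add: mod_eq_dvd_iff right_diff_distrib)
    then have "k dvd i - j" using assms
      by (simp add: coprime_commute coprime_dvd_mult_right_iff)
    then show "i = j" using ij by (metis atLeastLessThan_iff mod_eq_dvd_iff mod_pos_pos_trivial
          zle_add1_eq_le order_trans zero_le_one less_imp_le)
  qed
  moreover have "(\<lambda>j. h * j mod k) ` {1..<k} \<subseteq> {1..<k}"
    using mult_mod_pos[OF assms] by blast
  ultimately show ?thesis
    by (simp add: bij_betw_def endo_inj_surj)
qed

text \<open>Replacing a nonzero remainder \<open>r\<close> by \<open>k - r\<close> negates its
  sawtooth value.\<close>

lemma dsum_minus: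
  assumes "coprime h k"
  shows "dsum (- h) k = - dsum h k"
proof -
  have "of_int (- h * j mod k) / of_int k - 1/2 = - (of_int (h * j mod k) / of_int k - 1/2 :: real)"
    if "j \<in> {1..<k}" for j
  proof -
    have "- (h * j) mod k = k - h * j mod k"
      using mult_mod_pos[OF assms that] by (simp add: zmod_zminus1_eq_if)
    then have "real_of_int (- (h * j) mod k) = of_int k - of_int (h * j mod k)" by simp
    then show ?thesis using that by (simp add: diff_divide_distrib)
  qed
  then show ?thesis unfolding dsum_def sum_negf[symmetric]
    by (intro sum.cong refl) (metis mult_minus_right)
qed

text \<open>The substitution of \<open>h' * j\<close> for \<open>j\<close> exchanges the two
  sawtooth factors, because \<open>h * h'\<close> is 1 modulo \<open>k\<close>.\<close>

lemma dsum_inverse: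
  assumes "k > 0" "h * h' mod k = 1 mod k"
  shows "dsum h k = dsum h' k"
proof -
  have cop: "coprime h' k"
    using assms(2) by (metis coprime_mod_left_iff coprime_mult_left_iff coprime_1_left assms(1) less_irrefl)
  have "dsum h k = (\<Sum>j\<in>{1..<k}. (of_int (h' * j mod k) / of_int k - 1/2)
      * (of_int (h * (h' * j mod k) mod k) / of_int k - 1/2))"
    unfolding dsum_def
    using sum.reindex_bij_betw[OF bij_betw_mult_mod[OF cop], symmetric] by simp
  also have "\<dots> = dsum h' k"
    unfolding dsum_def
  proof (intro sum.cong refl)
    fix j assume j: "j \<in> {1..<k}"
    have "h * (h' * j mod k) mod k = (h * h' mod k) * j mod k"
      by (simp add: mod_simps mult.assoc)
    also have "\<dots> = j" using j by (simp add: assms(2) mod_simps)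
    finally show "(of_int (h' * j mod k) / of_int k - 1/2)
      * (of_int (h * (h' * j mod k) mod k) / of_int k - 1/2) =
     (of_int j / of_int k - 1/2) * (of_int (h' * j mod k) / of_int k - 1/2 :: real)"
      by simp
  qed
  finally show ?thesis .
qed

section \<open>Reciprocity by counting lattice points below a line\<close>

lemma sum_int_interval:
  fixes k :: int
  assumes "k \<ge> 1"
  shows "(\<Sum>j\<in>{1..<k}. (of_int j :: real)) = of_int k * (of_int k - 1) / 2"
  using assms
proof (induction k rule: int_ge_induct)
  case (step i)
  have "{1..<i + 1} = insert i {1..<i}" using step by auto
  then show ?case using step by (simp add: field_simps)
qed auto

lemma sum_squares_int_interval:
  fixes k :: int
  assumes "k \<ge> 1"
  shows "(\<Sum>j\<in>{1..<k}. (of_int j :: real)\<^sup>2) = of_int k * (of_int k - 1) * (2 * of_int k - 1) / 6"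
  using assms
proof (induction k rule: int_ge_induct)
  case (step i)
  have "{1..<i + 1} = insert i {1..<i}" using step by auto
  then show ?case using step by (simp add: field_simps power2_eq_square)
qed auto

lemma sum_int_from_1:
  fixes n :: int
  assumes "n \<ge> 0"
  shows "(\<Sum>i\<in>{1..n}. 2 * i) = n * (n + 1)"
  using assms
proof (induction n rule: int_ge_induct)
  case (step i)
  have "{1..i + 1} = insert (i + 1) {1..i}" using step by auto
  then show ?case using step by (simp add: algebra_simps)
qed auto

lemma int_div_less_iff:
  fixes a b c :: int
  assumes "c > 0"
  shows "a div c < b \<longleftrightarrow> a < b * c"
proof
  assume "a div c < b"
  then have "(a div c + 1) * c \<le> b * c" using assms by (intro mult_right_mono) auto
  moreover have "a = a div c * c + a mod c" "a mod c < c" using assms by simp_all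
  ultimately show "a < b * c" unfolding distrib_right mult_1 by linarith
next
  assume "a < b * c"
  moreover have "a = a div c * c + a mod c" "0 \<le> a mod c" using assms by simp_all
  ultimately have "a div c * c < b * c" by linarith
  then show "a div c < b" using assms by simp
qed

text \<open>Double counting of the points \<open>(i, j)\<close> with \<open>k * i < h * j\<close>,
  each with weight \<open>2 * i\<close>. For fixed \<open>j\<close> the weights add up to
  \<open>q * (q + 1)\<close> with \<open>q = h * j div k\<close>; for fixed \<open>i\<close> only
  the number of admissible \<open>j\<close> matters. Coprimality keeps the points of the rectangle
  off the line.\<close>

lemma sum_div_swap:
  fixes h k :: int
  assumes "coprime h k" "h > 0" "k > 0"
  shows "(\<Sum>j\<in>{1..<k}. (h * j div k) * (h * j div k + 1)) = (\<Sum>i\<in>{1..<h}. 2 * i * (k - 1 - k * i div h))"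
proof -
  have A: "{i \<in> {1..<h}. k * i < h * j} = {1..h * j div k}" if j: "j \<in> {1..<k}" for j
  proof -
    have "h * j mod k \<in> {1..<k}" using mult_mod_pos[OF assms(1) j] .
    then have e: "h * j = k * (h * j div k) + h * j mod k" "0 < h * j mod k" "h * j mod k < k" by auto
    have "k * (h * j div k) < k * h"
    proof -
      have "h * j < h * k" using j assms by simp
      then show ?thesis using e mult.commute[of h k] by linarith
    qed
    then have lt: "h * j div k < h" using assms by simp
    have iff: "k * i < h * j \<longleftrightarrow> i \<le> h * j div k" for i
    proof
      assume "k * i < h * j"
      then have "i * k \<le> h * j" by (simp add: mult.commute)
      then show "i \<le> h * j div k"
        using zdiv_mono1[of "i * k" "h * j" k] assms(3) by simp
    next
      assume "i \<le> h * j div k"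
      then have "k * i \<le> k * (h * j div k)" using assms by simp
      then show "k * i < h * j" using e by linarith
    qed
    show ?thesis using lt by (auto simp: iff)
  qed
  have B: "{j \<in> {1..<k}. k * i < h * j} = {k * i div h + 1..<k}" if i: "i \<in> {1..<h}" for i
  proof -
    have iff: "k * i < h * j \<longleftrightarrow> k * i div h < j" for j
      using int_div_less_iff[of h "k * i" j] assms by (simp add: mult.commute)
    have "0 \<le> k * i div h" using assms i by (simp add: pos_imp_zdiv_nonneg_iff)
    then show ?thesis by (auto simp: iff)
  qed
  have "(\<Sum>j\<in>{1..<k}. (h * j div k) * (h * j div k + 1)) = (\<Sum>j\<in>{1..<k}. \<Sum>i | i \<in> {1..<h} \<and> k * i < h * j. 2 * i)"
  proof (intro sum.cong refl)
    fix j assume j: "j \<in> {1..<k}"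
    have "0 \<le> h * j div k" using assms j by (simp add: pos_imp_zdiv_nonneg_iff)
    then show "(h * j div k) * (h * j div k + 1) = (\<Sum>i | i \<in> {1..<h} \<and> k * i < h * j. 2 * i)"
      using A[OF j] sum_int_from_1 by simp
  qed
  also have "\<dots> = (\<Sum>i\<in>{1..<h}. \<Sum>j | j \<in> {1..<k} \<and> k * i < h * j. 2 * i)"
    by (rule sum.swap_restrict) auto
  also have "\<dots> = (\<Sum>i\<in>{1..<h}. 2 * i * (k - 1 - k * i div h))"
  proof (intro sum.cong refl)
    fix i assume i: "i \<in> {1..<h}"
    have "k * i div h < k"
      using i assms by (simp add: int_div_less_iff)
    then show "(\<Sum>j | j \<in> {1..<k} \<and> k * i < h * j. 2 * i) = 2 * i * (k - 1 - k * i div h)"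
      unfolding B[OF i] by simp
  qed
  finally show ?thesis .
qed

text \<open>Everything follows from writing the remainder as
  \<open>h * j - k * (h * j div k)\<close>. The first equation expands the product in
  \<open>dsum\<close>; the other two hold because the remainders permute
  \<open>1, ..., k - 1\<close>, so that their sum and the sum of their squares are known.\<close>

lemma dsum_alt:
  assumes "coprime h k" "k > 0"
  defines "F \<equiv> \<Sum>j\<in>{1..<k}. of_int j * of_int (h * j div k) :: real"
    and "G \<equiv> \<Sum>j\<in>{1..<k}. of_int (h * j div k) ^ 2 :: real"
    and "H \<equiv> \<Sum>j\<in>{1..<k}. of_int (h * j div k) :: real"
    and "Q \<equiv> of_int k * (of_int k - 1) * (2 * of_int k - 1) / 6 :: real"
    and "T \<equiv> of_int k * (of_int k - 1) / 2 :: real"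
  shows "dsum h k * (of_int k)\<^sup>2 = of_int h * Q - of_int k * F - (of_int k)\<^sup>2 * (of_int k - 1) / 4"
    and "(of_int h)\<^sup>2 * Q - 2 * of_int h * of_int k * F + (of_int k)\<^sup>2 * G = Q"
    and "of_int h * T - of_int k * H = T"
proof -
  define r where "r j = h * j mod k" for j
  have r: "of_int (r j) = of_int h * of_int j - of_int k * (of_int (h * j div k) :: real)" for j
    unfolding r_def by (simp add: minus_mult_div_eq_mod[symmetric])
  have perm: "(\<Sum>j\<in>{1..<k}. f (r j)) = (\<Sum>j\<in>{1..<k}. f j)" for f :: "int \<Rightarrow> real"
    unfolding r_def by (rule sum.reindex_bij_betw[OF bij_betw_mult_mod[OF assms(1)]])
  have k1: "k \<ge> 1" using assms by simp
  have T: "(\<Sum>j\<in>{1..<k}. (of_int j :: real)) = T" and Q: "(\<Sum>j\<in>{1..<k}. (of_int j :: real)\<^sup>2) = Q"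
    using sum_int_interval[OF k1] sum_squares_int_interval[OF k1] by (simp_all add: T_def Q_def)
  show 3: "of_int h * T - of_int k * H = T"
    using perm[of of_int] by (simp add: r sum_subtractf sum_distrib_left[symmetric] T H_def)
  have "(\<Sum>j\<in>{1..<k}. (of_int (r j) :: real)\<^sup>2)
     = (of_int h)\<^sup>2 * Q - 2 * of_int h * of_int k * F + (of_int k)\<^sup>2 * G"
    unfolding r F_def G_def Q[symmetric] sum_distrib_left sum_subtractf[symmetric] sum.distrib[symmetric]
    by (intro sum.cong refl) (simp add: power2_eq_square algebra_simps)
  then show "(of_int h)\<^sup>2 * Q - 2 * of_int h * of_int k * F + (of_int k)\<^sup>2 * G = Q"
    using perm[of "\<lambda>i. (of_int i)\<^sup>2"] Q by simp
  have "dsum h k * (of_int k)\<^sup>2 = (\<Sum>j\<in>{1..<k}. of_int j * of_int (r j) - of_int k / 2 * of_int j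
      - of_int k / 2 * of_int (r j) + (of_int k)\<^sup>2 / 4)"
    unfolding dsum_def r_def sum_distrib_right
    using assms(2) by (intro sum.cong refl) (simp add: field_simps power2_eq_square)
  also have "\<dots> = (\<Sum>j\<in>{1..<k}. of_int j * of_int (r j)) - of_int k / 2 * T - of_int k / 2 * T
      + (of_int k - 1) * ((of_int k)\<^sup>2 / 4)"
    using k1 perm[of of_int] by (simp add: sum.distrib sum_subtractf sum_distrib_left[symmetric] T
      flip: sum_divide_distrib)
  also have "(\<Sum>j\<in>{1..<k}. of_int j * of_int (r j)) = of_int h * Q - of_int k * F"
    unfolding r F_def Q[symmetric] sum_distrib_left sum_subtractf[symmetric]
    by (intro sum.cong refl) (simp add: power2_eq_square algebra_simps)
  finally show "dsum h k * (of_int k)\<^sup>2 = of_int h * Q - of_int k * F - (of_int k)\<^sup>2 * (of_int k - 1) / 4"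
    by (simp add: T_def field_simps power2_eq_square)
qed

text \<open>The quadratic relation expresses \<open>F\<close> by \<open>G\<close>, the linear one
  gives \<open>H\<close>, and the double count expresses \<open>G + H\<close> by \<open>F'\<close>,
  the mixed sum with \<open>h\<close> and \<open>k\<close> exchanged. Thus \<open>F'\<close> is the
  only unknown left.\<close>

lemma dsum_reciprocity:
  assumes "coprime h k" "h > 0" "k > 0"
  shows "12 * (dsum h k + dsum k h) =
    (1 + (of_int h)\<^sup>2 + (of_int k)\<^sup>2) / (of_int h * of_int k) - 3"
proof -
  define F where "F = (\<Sum>j\<in>{1..<k}. of_int j * of_int (h * j div k) :: real)"
  define G where "G = (\<Sum>j\<in>{1..<k}. of_int (h * j div k) ^ 2 :: real)"
  define H where "H = (\<Sum>j\<in>{1..<k}. of_int (h * j div k) :: real)"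
  define F' where "F' = (\<Sum>j\<in>{1..<h}. of_int j * of_int (k * j div h) :: real)"
  define a b where "a = (of_int h :: real)" and "b = (of_int k :: real)"
  have pos: "a > 0" "b > 0" using assms by (auto simp: a_def b_def)
  note 1 = dsum_alt[OF assms(1,3), folded F_def G_def H_def a_def b_def]
  note 2 = dsum_alt(1)[of k h, folded F'_def a_def b_def]
  have 2: "dsum k h * a\<^sup>2 = b * (a * (a - 1) * (2 * a - 1) / 6) - a * F' - a\<^sup>2 * (a - 1) / 4"
    using 2 assms by (simp add: coprime_commute)
  have sT: "(\<Sum>i\<in>{1..<h}. (of_int i :: real)) = a * (a - 1) / 2"
    unfolding a_def using assms by (intro sum_int_interval) simp
  have "real_of_int (\<Sum>j\<in>{1..<k}. (h * j div k) * (h * j div k + 1)) = G + H"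
    by (simp add: G_def H_def sum.distrib power2_eq_square algebra_simps)
  moreover have "real_of_int (\<Sum>i\<in>{1..<h}. 2 * i * (k - 1 - k * i div h)) = (b - 1) * 2 * (a * (a - 1) / 2) - 2 * F'"
    unfolding F'_def sT[symmetric] sum_distrib_left of_int_sum sum_subtractf[symmetric]
    by (intro sum.cong refl) (simp add: b_def algebra_simps)
  ultimately have "G + H = (b - 1) * 2 * (a * (a - 1) / 2) - 2 * F'"
    unfolding sum_div_swap[OF assms] by linarith
  then have D: "G + H = (b - 1) * a * (a - 1) - 2 * F'" by (simp add: algebra_simps)
  have H: "H = (a - 1) * (b - 1) / 2"
  proof -
    have "b * H = b * ((a - 1) * (b - 1) / 2)" using 1(3) by (simp add: field_simps)
    then show ?thesis using pos by simp
  qed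
  have G: "G = (b - 1) * a * (a - 1) - 2 * F' - (a - 1) * (b - 1) / 2" using D H by simp
  have F: "2 * a * b * F = a\<^sup>2 * (b * (b - 1) * (2 * b - 1) / 6) + b\<^sup>2 * G - b * (b - 1) * (2 * b - 1) / 6"
    using 1(2) by argo
  have S1: "dsum h k = (a * (b * (b - 1) * (2 * b - 1) / 6) - b * F - b\<^sup>2 * (b - 1) / 4) / b\<^sup>2"
    using 1(1) pos by (simp add: field_simps)
  have S2: "dsum k h = (b * (a * (a - 1) * (2 * a - 1) / 6) - a * F' - a\<^sup>2 * (a - 1) / 4) / a\<^sup>2"
    using 2 pos by (simp add: field_simps)
  have F: "F = (a\<^sup>2 * (b * (b - 1) * (2 * b - 1) / 6) + b\<^sup>2 * G - b * (b - 1) * (2 * b - 1) / 6) / (2 * a * b)"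
    using F pos by (simp add: field_simps)
  \<comment> \<open>\<open>F'\<close> enters \<open>dsum h k\<close> as \<open>F' / a\<close> and
    \<open>dsum k h\<close> as \<open>- F' / a\<close>, so it drops out.\<close>
  show ?thesis
    unfolding a_def[symmetric] b_def[symmetric] S1 S2 F G
    using pos by (simp add: divide_simps) algebra
qed

section \<open>The three-term law\<close>

definition idet :: "int \<times> int \<Rightarrow> int \<times> int \<Rightarrow> int" where
  "idet x y = fst x * snd y - snd x * fst y"

definition iprim :: "int \<times> int \<Rightarrow> bool" where
  "iprim x \<longleftrightarrow> coprime (fst x) (snd x)"

lemma idet_self [simp]: "idet x x = 0"
  by (simp add: idet_def)

lemma idet_swap: "idet y x = - idet x y"
  by (simp add: idet_def)

lemma idet_minus [simp]: "idet (- x) y = - idet x y" "idet x (- y) = - idet x y"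
  by (simp_all add: idet_def)

lemma iprim_minus [simp]: "iprim (- x) = iprim x"
  by (simp add: iprim_def)

lemma iprim_idet_1:
  assumes "idet x y = 1 \<or> idet x y = -1"
  shows "iprim x" "iprim y"
proof -
  have u: "is_unit (fst x * snd y - snd x * fst y)" using assms by (auto simp: idet_def)
  show "iprim x" unfolding iprim_def
    by (rule coprimeI) (meson dvd_diff dvd_mult2 dvd_trans u)
  show "iprim y" unfolding iprim_def
    by (rule coprimeI) (meson dvd_diff dvd_mult dvd_trans u)
qed

lemma iprim_complement:
  assumes "iprim x"
  obtains u where "idet x u = 1"
proof -
  obtain a b where "a * fst x + b * snd x = 1"
    using assms bezout_int[of "fst x" "snd x"] by (auto simp: iprim_def)
  then have "idet x (- b, a) = 1" by (simp add: idet_def algebra_simps)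
  then show ?thesis by (rule that)
qed

text \<open>Cramer's rule in the lattice basis \<open>x\<close>, \<open>u\<close>.\<close>

lemma idet_basis:
  assumes "idet x u = 1"
  shows "y = (idet y u * fst x + idet x y * fst u, idet y u * snd x + idet x y * snd u)"
proof -
  have *: "fst x * snd u = 1 + snd x * fst u" using assms by (simp add: idet_def)
  have 1: "idet y u * fst x + idet x y * fst u = fst y * (fst x * snd u - snd x * fst u)"
    by (simp add: idet_def algebra_simps)
  have 2: "idet y u * snd x + idet x y * snd u = snd y * (fst x * snd u - snd x * fst u)"
    by (simp add: idet_def algebra_simps)
  show ?thesis using * unfolding 1 2 by (simp add: prod_eq_iff)
qed

text \<open>Up to sign these are the coordinates of \<open>y\<close> in the basis \<open>x\<close>,
  \<open>u\<close>, so a common divisor would divide \<open>y\<close>.\<close>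

lemma coprime_idet:
  assumes "idet x u = 1" "iprim y"
  shows "coprime (idet u y) (idet x y)"
proof (rule coprimeI)
  fix c assume c: "c dvd idet u y" "c dvd idet x y"
  then have "c dvd idet y u" by (simp add: idet_swap[of y u])
  then have "c dvd fst y" "c dvd snd y"
    using c idet_basis[OF assms(1), of y] by (metis dvd_add dvd_mult2 fst_conv snd_conv)+
  then show "is_unit c" using assms(2) coprime_common_divisor unfolding iprim_def by blast
qed

text \<open>The Dedekind sum of the cone spanned by \<open>x\<close> and \<open>y\<close>, signed by the orientation of \<open>(x, y)\<close>. The choice of the
  complement \<open>u\<close> of \<open>x\<close> is immaterial for primitive \<open>x\<close> (lemma \<open>dpair_eq\<close>).\<close>

definition dpair :: "int \<times> int \<Rightarrow> int \<times> int \<Rightarrow> real" where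
  "dpair x y = of_int (sgn (idet x y)) * dsum (idet (SOME u. idet x u = 1) y) \<bar>idet x y\<bar>"

text \<open>Two complements of \<open>x\<close> differ by a multiple of \<open>x\<close>, which
  changes the first argument of \<open>dsum\<close> by a multiple of the determinant.\<close>

lemma dpair_eq:
  assumes "idet x u = 1"
  shows "dpair x y = of_int (sgn (idet x y)) * dsum (idet u y) \<bar>idet x y\<bar>"
proof -
  define u' where "u' = (SOME u. idet x u = 1)"
  have "idet x u' = 1" unfolding u'_def by (rule someI[of _ u]) fact
  then have "u' = (idet u' u * fst x + fst u, idet u' u * snd x + snd u)"
    using idet_basis[OF assms, of u'] by simp
  then have "fst u' = idet u' u * fst x + fst u" "snd u' = idet u' u * snd x + snd u"
    by (metis fst_conv snd_conv)+
  then have "idet u' y = idet u y + idet u' u * idet x y"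
    unfolding idet_def[of u' y] by (simp add: idet_def[of u y] idet_def[of x y] algebra_simps)
  then have "idet u' y mod \<bar>idet x y\<bar> = idet u y mod \<bar>idet x y\<bar>"
    by (simp add: mod_eq_dvd_iff)
  then show ?thesis unfolding dpair_def u'_def[symmetric] using dsum_cong_mod by metis
qed

text \<open>The arguments of the two Dedekind sums are inverse to each other modulo the determinant,
  so \<open>dsum_inverse\<close> identifies them; only the orientation sign changes.\<close>

lemma dpair_swap:
  assumes "iprim x" "iprim y"
  shows "dpair y x = - dpair x y"
proof (cases "idet x y = 0")
  case True
  then show ?thesis by (simp add: dpair_def idet_swap[of y x])
next
  case False
  obtain u where u: "idet x u = 1" using iprim_complement assms by blast
  obtain w where w: "idet y w = 1" using iprim_complement assms by blast
  \<comment> \<open>The Pluecker relation for the four vectors \<open>x\<close>, \<open>y\<close>,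
    \<open>u\<close>, \<open>w\<close>.\<close>
  have "idet u y * idet w x - idet x u * idet y w = idet u w * - idet x y"
    unfolding idet_def by algebra
  then have "idet u y * idet w x = 1 - idet u w * idet x y" by (simp add: u w)
  then have "idet u y * idet w x mod \<bar>idet x y\<bar> = 1 mod \<bar>idet x y\<bar>"
    by (simp add: mod_eq_dvd_iff)
  from dsum_inverse[OF _ this] False show ?thesis
    by (simp add: dpair_eq[OF u] dpair_eq[OF w] idet_swap[of y x] sgn_minus)
qed

text \<open>The orientation and the odd function \<open>dsum\<close> change sign together. So
  \<open>dpair\<close> depends only on the lines spanned by its arguments.\<close>

lemma dpair_minus_right:
  assumes "iprim x" "iprim y"
  shows "dpair x (- y) = dpair x y"
proof -
  obtain u where u: "idet x u = 1" using iprim_complement assms by blast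
  show ?thesis
    using dsum_minus[of "idet u y" "\<bar>idet x y\<bar>"] coprime_idet[OF u assms(2)]
    by (simp add: dpair_eq[OF u] sgn_minus)
qed

lemma dpair_minus_left:
  assumes "iprim x" "iprim y"
  shows "dpair (- x) y = dpair x y"
  using assms by (metis dpair_minus_right dpair_swap iprim_minus)

text \<open>Rademacher's right-hand side a/(bc) + b/(ca) + c/(ab) - 3 over a common denominator.
  With \<open>sgn\<close> in place of 1 it is antisymmetric like the left-hand side, so the law
  makes sense for every orientation.\<close>

definition three_term :: "int \<times> int \<Rightarrow> int \<times> int \<Rightarrow> int \<times> int \<Rightarrow> bool" where
  "three_term x y z \<longleftrightarrow> 12 * (dpair x y + dpair y z + dpair z x) =
     of_int ((idet x y)\<^sup>2 + (idet y z)\<^sup>2 + (idet z x)\<^sup>2) / of_int (idet x y * idet y z * idet z x)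
     - 3 * of_int (sgn (idet x y * idet y z * idet z x))"

lemma three_term_swap:
  assumes "three_term x y z" "iprim x" "iprim y" "iprim z"
  shows "three_term y x z"
proof -
  have e: "idet y x * idet x z * idet z y = - (idet x y * idet y z * idet z x)"
    using idet_swap[of y x] idet_swap[of x z] idet_swap[of z y] by simp
  have "12 * (dpair y x + dpair x z + dpair z y) = - (12 * (dpair x y + dpair y z + dpair z x))"
    using dpair_swap[of x y] dpair_swap[of z x] dpair_swap[of y z] assms by simp
  also have "\<dots> = - (of_int ((idet x y)\<^sup>2 + (idet y z)\<^sup>2 + (idet z x)\<^sup>2) / of_int (idet x y * idet y z * idet z x)
     - 3 * of_int (sgn (idet x y * idet y z * idet z x)))"
    using assms(1) unfolding three_term_def by simp
  also have "\<dots> = of_int ((idet y x)\<^sup>2 + (idet x z)\<^sup>2 + (idet z y)\<^sup>2) / of_int (idet y x * idet x z * idet z y)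
     - 3 * of_int (sgn (idet y x * idet x z * idet z y))"
    unfolding e using idet_swap[of y x] idet_swap[of x z] idet_swap[of z y]
    by (simp add: sgn_minus add_ac del: of_int_mult of_int_add)
  finally show ?thesis unfolding three_term_def .
qed

lemma three_term_rotate: "three_term x y z \<Longrightarrow> three_term y z x"
  unfolding three_term_def by (simp add: add_ac mult_ac)

text \<open>Two of the three determinants change sign, so their product stays, and
  \<open>dpair\<close> does not see signs.\<close>

lemma three_term_minus:
  assumes "three_term x y z" "iprim x" "iprim y" "iprim z"
  shows "three_term x (- y) z"
  using assms unfolding three_term_def by (simp add: dpair_minus_left dpair_minus_right)

text \<open>As \<open>dsum\<close> is odd in its first argument, the signs come out as the factor
  \<open>sgn (a * b)\<close>, which turns the denominator of the positive case into
  \<open>a * b\<close>.\<close>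

lemma dsum_reciprocity_signed:
  assumes "coprime a b" "a \<noteq> 0" "b \<noteq> 0"
  shows "12 * (of_int (sgn a) * dsum b \<bar>a\<bar> + of_int (sgn b) * dsum a \<bar>b\<bar>) =
    (1 + (of_int a)\<^sup>2 + (of_int b)\<^sup>2) / (of_int a * of_int b) - 3 * of_int (sgn (a * b))"
proof -
  have c: "coprime \<bar>a\<bar> \<bar>b\<bar>" using assms by simp
  have 1: "dsum b \<bar>a\<bar> = of_int (sgn b) * dsum \<bar>b\<bar> \<bar>a\<bar>"
    using dsum_minus[of "\<bar>b\<bar>" "\<bar>a\<bar>"] c assms by (cases "b > 0") (auto simp: coprime_commute)
  have 2: "dsum a \<bar>b\<bar> = of_int (sgn a) * dsum \<bar>a\<bar> \<bar>b\<bar>"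
    using dsum_minus[of "\<bar>a\<bar>" "\<bar>b\<bar>"] c assms by (cases "a > 0") (auto simp: coprime_commute)
  have "12 * (of_int (sgn a) * dsum b \<bar>a\<bar> + of_int (sgn b) * dsum a \<bar>b\<bar>)
      = of_int (sgn (a * b)) * (12 * (dsum \<bar>a\<bar> \<bar>b\<bar> + dsum \<bar>b\<bar> \<bar>a\<bar>))"
    unfolding 1 2 by (simp add: sgn_mult algebra_simps)
  also have "\<dots> = of_int (sgn (a * b)) * ((1 + (of_int a)\<^sup>2 + (of_int b)\<^sup>2) / \<bar>of_int a * of_int b\<bar> - 3)"
    using dsum_reciprocity[OF c] assms by (simp add: abs_mult)
  also have "\<dots> = (1 + (of_int a)\<^sup>2 + (of_int b)\<^sup>2) / (of_int a * of_int b) - 3 * of_int (sgn (a * b))"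
  proof (cases "a * b > 0")
    case True
    then have "real_of_int a * of_int b > 0" by (metis of_int_0_less_iff of_int_mult)
    with True show ?thesis by simp
  next
    case False
    then have n: "a * b < 0" using assms by (simp add: linorder_neq_iff[of _ 0, symmetric] linorder_not_less le_less)
    then have "real_of_int a * of_int b < 0" by (metis of_int_less_0_iff of_int_mult)
    with n show ?thesis by simp
  qed
  finally show ?thesis .
qed

text \<open>\<open>y\<close> is a complement of \<open>x\<close>, and \<open>- x\<close> one of
  \<open>y\<close>. Hence the first Dedekind sum vanishes and the other two have the arguments
  \<open>idet y z\<close> and \<open>idet z x\<close> in both orders: the law is reciprocity for
  these numbers.\<close>

lemma three_term_unimodular:
  assumes "idet x y = 1" "iprim z" "idet y z \<noteq> 0" "idet z x \<noteq> 0"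
  shows "three_term x y z"
proof -
  have xy: "iprim x" "iprim y" using iprim_idet_1[of x y] assms by auto
  have "dpair x y = 0" using dpair_eq[OF assms(1), of y] assms by simp
  moreover have "dpair x z = of_int (sgn (idet x z)) * dsum (idet y z) \<bar>idet x z\<bar>"
    by (rule dpair_eq[OF assms(1)])
  then have "dpair z x = of_int (sgn (idet z x)) * dsum (idet y z) \<bar>idet z x\<bar>"
    using dpair_swap[of x z] assms xy idet_swap[of x z] by (simp add: sgn_minus)
  moreover have "idet y (- x) = 1" using assms idet_swap[of y x] by simp
  then have "dpair y z = of_int (sgn (idet y z)) * dsum (idet z x) \<bar>idet y z\<bar>"
    using dpair_eq[of y "- x" z] idet_swap[of z x] by simp
  moreover have "coprime (idet y z) (idet z x)"
    using coprime_idet[OF assms(1,2)] idet_swap[of z x] by simp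
  ultimately show ?thesis
    unfolding three_term_def using dsum_reciprocity_signed[of "idet y z" "idet z x"] assms
    by (simp add: sgn_mult)
qed

text \<open>If \<open>y1 * z1\<close> and \<open>y2 * z2\<close> have equal signs, both sides
  vanish. Otherwise \<open>y1 * z2\<close> and \<open>y2 * z1\<close> have opposite signs, so their
  difference has the sign of \<open>y1 * z2\<close>, and the terms agree one by one.\<close>

lemma three_term_cocycle_signs:
  fixes y1 y2 z1 z2 :: real
  assumes "y1 \<noteq> 0" "y2 \<noteq> 0" "z1 \<noteq> 0" "z2 \<noteq> 0" "y1 * z2 - y2 * z1 \<noteq> 0"
  shows "sgn (y1 * z1 * (y1 * z2 - y2 * z1)) - sgn (y2 * z2 * (y1 * z2 - y2 * z1)) = sgn (z1 * z2) - sgn (y1 * y2)"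
proof -
  consider "y1 > 0" | "y1 < 0" using assms by linarith
  moreover consider "y2 > 0" | "y2 < 0" using assms by linarith
  moreover consider "z1 > 0" | "z1 < 0" using assms by linarith
  moreover consider "z2 > 0" | "z2 < 0" using assms by linarith
  ultimately show ?thesis
    using mult_pos_pos[of y1 z2] mult_pos_neg[of y1 z2] mult_neg_pos[of y1 z2] mult_neg_neg[of y1 z2]
      mult_pos_pos[of y2 z1] mult_pos_neg[of y2 z1] mult_neg_pos[of y2 z1] mult_neg_neg[of y2 z1]
    by (smt (verit) sgn_mult sgn_pos sgn_neg mult_minus_left mult_minus_right mult_1 mult_1_right)
qed

text \<open>The law for \<open>(x, y, z)\<close> is the law for \<open>(u, y, z)\<close> plus the
  one for \<open>(x, u, z)\<close> minus the one for \<open>(x, u, y)\<close>: on the left by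
  antisymmetry of \<open>dpair\<close>, on the right by an identity of fractions and one of
  signs.\<close>

lemma three_term_cocycle:
  assumes "idet x u = 1" "iprim x" "iprim y" "iprim z" "iprim u"
    and "idet x y \<noteq> 0" "idet y z \<noteq> 0" "idet z x \<noteq> 0" "idet u y \<noteq> 0" "idet u z \<noteq> 0"
    and "three_term x u y" "three_term x u z" "three_term u y z"
  shows "three_term x y z"
proof -
  \<comment> \<open>By \<open>idet_basis\<close> these are the coordinates of \<open>y\<close> and
    \<open>z\<close> in the basis \<open>x\<close>, \<open>u\<close>.\<close>
  define y1 y2 z1 z2 :: real where "y1 = of_int (idet y u)" "y2 = of_int (idet x y)"
    "z1 = of_int (idet z u)" "z2 = of_int (idet x z)"
  note d = this
  have nz: "y1 \<noteq> 0" "y2 \<noteq> 0" "z1 \<noteq> 0" "z2 \<noteq> 0"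
    using assms idet_swap[of y u] idet_swap[of z u] idet_swap[of x z] by (auto simp: d)
  have "idet y z = idet y u * idet x z - idet x y * idet z u"
  proof -
    have "idet y z * idet x u = idet y u * idet x z - idet x y * idet z u"
      unfolding idet_def by algebra
    then show ?thesis using assms by simp
  qed
  then have D: "real_of_int (idet y z) = y1 * z2 - y2 * z1" by (simp add: d)
  then have D0: "y1 * z2 - y2 * z1 \<noteq> 0" using assms by (metis of_int_eq_0_iff)
  have e: "real_of_int (idet u y) = - y1" "real_of_int (idet z u) = z1" "real_of_int (idet x z) = z2"
    "real_of_int (idet z x) = - z2" "real_of_int (idet y x) = - y2" "real_of_int (idet u z) = - z1"
    "real_of_int (idet y u) = y1" "real_of_int (idet x y) = y2" "real_of_int (idet x u) = 1"
    using assms idet_swap[of u y] idet_swap[of z x] idet_swap[of y x] idet_swap[of u z] by (simp_all add: d)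
  have sg: "real_of_int (sgn k) = sgn (of_int k)" for k :: int by (simp add: sgn_if)
  have 1: "12 * (dpair x u + dpair u y + dpair y x) = (1 + y1\<^sup>2 + y2\<^sup>2) / (y1 * y2) - 3 * sgn (y1 * y2)"
    using assms(11) by (simp add: three_term_def sg e add_ac)
  have 2: "12 * (dpair x u + dpair u z + dpair z x) = (1 + z1\<^sup>2 + z2\<^sup>2) / (z1 * z2) - 3 * sgn (z1 * z2)"
    using assms(12) by (simp add: three_term_def sg e add_ac)
  have 3: "12 * (dpair u y + dpair y z + dpair z u) = (y1\<^sup>2 + (y1 * z2 - y2 * z1)\<^sup>2 + z1\<^sup>2) / (- y1 * (y1 * z2 - y2 * z1) * z1)
     - 3 * sgn (- y1 * (y1 * z2 - y2 * z1) * z1)"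
    using assms(13) by (simp add: three_term_def sg e D)
  have a: "dpair y x = - dpair x y" "dpair z u = - dpair u z"
    by (rule dpair_swap; fact)+
  have R: "(y1\<^sup>2 + E\<^sup>2 + z1\<^sup>2) / (- y1 * E * z1) + (1 + z1\<^sup>2 + z2\<^sup>2) / (z1 * z2) - (1 + y1\<^sup>2 + y2\<^sup>2) / (y1 * y2)
      = (y2\<^sup>2 + E\<^sup>2 + z2\<^sup>2) / (y2 * E * - z2)" if "E = y1 * z2 - y2 * z1" "E \<noteq> 0" for E
  proof -
    \<comment> \<open>The common denominator. \<open>E\<close> stays an atom until the fractions are
      merged; its value enters only in the final polynomial identity.\<close>
    define P where "P = y1 * y2 * z1 * z2 * E"
    have f: "A / q = A * r / P" if "q * r = P" "r \<noteq> 0" for A q r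
      using that by (metis nonzero_mult_divide_mult_cancel_right)
    have f1: "A / (- y1 * E * z1) = A * - (y2 * z2) / P" for A
      by (rule f) (use nz in \<open>simp_all add: P_def mult_ac\<close>)
    have f2: "A / (z1 * z2) = A * (y1 * y2 * E) / P" for A
      by (rule f) (use nz that(2) in \<open>simp_all add: P_def mult_ac\<close>)
    have f3: "A / (y1 * y2) = A * (z1 * z2 * E) / P" for A
      by (rule f) (use nz that(2) in \<open>simp_all add: P_def mult_ac\<close>)
    have f4: "A / (y2 * E * - z2) = A * - (y1 * z1) / P" for A
      by (rule f) (use nz in \<open>simp_all add: P_def mult_ac\<close>)
    have "(y1\<^sup>2 + E\<^sup>2 + z1\<^sup>2) * - (y2 * z2) + (1 + z1\<^sup>2 + z2\<^sup>2) * (y1 * y2 * E) - (1 + y1\<^sup>2 + y2\<^sup>2) * (z1 * z2 * E)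
      = (y2\<^sup>2 + E\<^sup>2 + z2\<^sup>2) * - (y1 * z1)"
      unfolding that(1) by (simp add: algebra_simps power2_eq_square)
    then show ?thesis unfolding f1 f2 f3 f4 by (metis add_divide_distrib diff_divide_distrib)
  qed
  have s: "sgn (y2 * (y1 * z2 - y2 * z1) * - z2) = sgn (- y1 * (y1 * z2 - y2 * z1) * z1) + sgn (z1 * z2) - sgn (y1 * y2)"
  proof -
    have "y2 * E * - z2 = - (y2 * z2 * E)" "- y1 * E * z1 = - (y1 * z1 * E)" for E
      by (simp_all add: mult_ac)
    then show ?thesis using three_term_cocycle_signs[OF nz D0] by (simp only: sgn_minus)
  qed
  have "12 * (dpair x y + dpair y z + dpair z x) = 
     12 * (dpair u y + dpair y z + dpair z u) + 12 * (dpair x u + dpair u z + dpair z x)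
      - 12 * (dpair x u + dpair u y + dpair y x)"
    by (simp add: a)
  also have "\<dots> = (y2\<^sup>2 + (y1 * z2 - y2 * z1)\<^sup>2 + z2\<^sup>2) / (y2 * (y1 * z2 - y2 * z1) * - z2)
      - 3 * sgn (y2 * (y1 * z2 - y2 * z1) * - z2)"
    unfolding 1 2 3 R[OF refl D0, symmetric] s by (simp add: algebra_simps)
  finally show ?thesis unfolding three_term_def by (simp add: sg e D)
qed

lemma idet_eq_0_iprim:
  assumes "iprim x" "iprim y" "idet x y = 0"
  shows "y = x \<or> y = - x"
proof -
  obtain u where u: "idet x u = 1" using iprim_complement assms by blast
  define a where "a = idet y u"
  have y: "y = (a * fst x, a * snd x)" using idet_basis[OF u, of y] assms by (simp add: a_def)
  then have "a dvd fst y" "a dvd snd y" by simp_all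
  then have "is_unit a" using assms(2) by (auto simp: iprim_def dest: coprime_common_divisor)
  then have "a = 1 \<or> a = -1" by auto
  then show ?thesis using y by (auto simp: prod_eq_iff)
qed

text \<open>Both sides of the law are cocycles, so \<open>(x, y, z)\<close> reduces to \<open>(u, y, z)\<close> with \<open>det (x, u) = 1\<close> and
  \<open>det (u, y)\<close> reduced modulo \<open>det (x, y)\<close>; triples with a unimodular pair are Dedekind reciprocity.\<close>

theorem three_term_law:
  assumes "iprim x" "iprim y" "iprim z" "idet x y \<noteq> 0" "idet y z \<noteq> 0" "idet z x \<noteq> 0"
  shows "three_term x y z"
  using assms
proof (induction "nat \<bar>idet x y\<bar>" arbitrary: x y rule: less_induct)
  case less
  note [simp] = less.prems(1-3)
  show ?case
  proof (cases "\<bar>idet x y\<bar> = 1")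
    case True
    then consider "idet x y = 1" | "idet x (- y) = 1" by force
    then show ?thesis
    proof cases
      case 1
      then show ?thesis using three_term_unimodular less.prems by blast
    next
      case 2
      then have "three_term x (- y) z" using three_term_unimodular less.prems by simp
      then show ?thesis using three_term_minus[of x "- y" z] by simp
    qed
  next
    case False
    obtain w where w: "idet x w = 1" using iprim_complement[of x] by auto
    \<comment> \<open>Euclidean division: subtracting \<open>k\<close> times \<open>x\<close> from
      \<open>w\<close> turns \<open>idet w y\<close> into its remainder, so the pair
      \<open>u\<close>, \<open>y\<close> has a smaller determinant than \<open>x\<close>,
      \<open>y\<close>.\<close>
    define k where "k = idet w y div idet x y"
    define u where "u = (fst w - k * fst x, snd w - k * snd x)"
    have xu: "idet x u = 1" using w by (simp add: u_def idet_def algebra_simps)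
    have "iprim u" using iprim_idet_1(2)[of x u] xu by simp
    note [simp] = this
    have "idet u y = idet w y - k * idet x y" by (simp add: u_def idet_def algebra_simps)
    then have "idet u y = idet w y mod idet x y" by (simp add: k_def minus_div_mult_eq_mod)
    then have lt: "\<bar>idet u y\<bar> < \<bar>idet x y\<bar>" using less.prems by (simp add: abs_mod_less)
    have uy: "idet u y \<noteq> 0"
    proof
      assume "idet u y = 0"
      then have "y = u \<or> y = - u" using idet_eq_0_iprim[of u y] by simp
      then show False using xu False by auto
    qed
    have xuy: "three_term x u y"
      using three_term_unimodular[OF xu, of y] uy less.prems idet_swap[of y x] by simp
    show ?thesis
    \<comment> \<open>The cocycle identity divides by \<open>idet u z\<close>. If that is 0, then
      \<open>z\<close> is \<open>u\<close> up to sign, and the triple is a rearrangement of the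
      unimodular one \<open>x\<close>, \<open>u\<close>, \<open>y\<close>.\<close>
    proof (cases "idet u z = 0")
      case True
      then have z: "z = u \<or> z = - u" using idet_eq_0_iprim[of u z] by simp
      have "three_term x y u"
        by (metis less.prems(1,2) \<open>iprim u\<close> three_term_rotate three_term_swap xuy)
      then show ?thesis
        using z three_term_minus[of u x y] by (metis less.prems(1,2) \<open>iprim u\<close> three_term_rotate three_term_minus)
    next
      case False
      then have "three_term x u z"
        using three_term_unimodular[OF xu, of z] less.prems by simp
      moreover have "three_term u y z"
        using less.hyps[of u y] lt uy less.prems False idet_swap[of z u] by simp
      ultimately show ?thesis
        using three_term_cocycle[OF xu] uy False xuy less.prems by simp
    qed
  qed
qed

section \<open>Convex lattice polygons and their duals\<close>

definition cross :: "real^2 \<Rightarrow> real^2 \<Rightarrow> real" where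
  "cross x y = x $ 1 * y $ 2 - x $ 2 * y $ 1"

text \<open>The quarter turn makes \<open>cross\<close> an inner product, so that half-planes and
  the Cauchy-Schwarz inequality become available for it.\<close>

definition rot :: "real^2 \<Rightarrow> real^2" where
  "rot x = vector [- (x $ 2), x $ 1]"

lemma rot_nth [simp]: "rot x $ 1 = - (x $ 2)" "rot x $ 2 = x $ 1"
  by (simp_all add: rot_def)

lemma inner_2: "(x :: real^2) \<bullet> y = x $ 1 * y $ 1 + x $ 2 * y $ 2"
  by (simp add: inner_vec_def sum_2)

lemma vec_eq_2: "(x :: real^2) = y \<longleftrightarrow> x $ 1 = y $ 1 \<and> x $ 2 = y $ 2"
  by (simp add: vec_eq_iff forall_2)

lemma rot_inner: "rot x \<bullet> y = cross x y"
  by (simp add: cross_def inner_2)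

lemma cross_simps [simp]: "cross x x = 0" "cross 0 x = 0" "cross x 0 = 0"
  by (simp_all add: cross_def)

lemma cross_swap: "cross y x = - cross x y"
  by (simp add: cross_def)

lemma cross_add: "cross (x + y) z = cross x z + cross y z" "cross x (y + z) = cross x y + cross x z"
  by (simp_all add: cross_def algebra_simps)

lemma cross_diff: "cross (x - y) z = cross x z - cross y z" "cross x (y - z) = cross x y - cross x z"
  by (simp_all add: cross_def algebra_simps)

lemma cross_scale: "cross (a *\<^sub>R x) z = a * cross x z" "cross x (a *\<^sub>R z) = a * cross x z"
  by (simp_all add: cross_def algebra_simps)

lemma cross_basis:
  assumes "cross v w \<noteq> 0"
  shows "x = (cross x w / cross v w) *\<^sub>R v + (cross v x / cross v w) *\<^sub>R w"
proof -
  have "cross v w * x $ i = cross x w * v $ i + cross v x * w $ i" for i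
    using exhaust_2[of i] by (auto simp: cross_def algebra_simps)
  then have "x $ i = (cross x w * v $ i + cross v x * w $ i) / cross v w" for i
    using assms by (simp add: field_simps)
  then show ?thesis
    by (simp add: vec_eq_iff add_divide_distrib)
qed

text \<open>Among the lines through \<open>v\<close> and a vertex \<open>x\<close> on the left of \<open>v\<close>, the one of least slope in the coordinates
  given by \<open>v\<close> and \<open>rot v\<close> supports the polygon.\<close>

lemma next_vertex:
  fixes P :: "(real^2) set"
  assumes "convex P" "finite (vertices P)" "P = convex hull (vertices P)" "0 \<in> interior P" "v \<in> vertices P"
  obtains w where "w \<in> vertices P" "cross v w > 0"
    "\<And>x. \<lbrakk>x \<in> vertices P; x \<noteq> v; x \<noteq> w\<rbrakk> \<Longrightarrow> cross v x + cross x w < cross v w"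
proof -
  have zP: "0 \<in> P" using assms(4) interior_subset by blast
  have VP: "x \<in> P" if "x \<in> vertices P" for x
    using that by (auto simp: vertices_def extreme_point_of_def)
  have ext: "x \<notin> open_segment a b" if "x \<in> vertices P" "a \<in> P" "b \<in> P" for x a b
    using that by (auto simp: vertices_def extreme_point_of_def)
  have v0: "v \<noteq> 0"
  proof
    assume v: "v = 0"
    have "\<not> v extreme_point_of P"
      using assms(4) v extreme_point_not_in_interior[of 0 P] by auto
    then show False using assms(5) by (simp add: vertices_def)
  qed
  \<comment> \<open>No point of \<open>P\<close> lies beyond \<open>v\<close> on its ray, since the
    segment from the origin to it would contain \<open>v\<close> in its interior.\<close>
  have shrink: "\<tau> \<le> 1" if "\<tau> *\<^sub>R v \<in> P" for \<tau>
  proof (rule ccontr)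
    assume t: "\<not> \<tau> \<le> 1"
    have "v = (1 - inverse \<tau>) *\<^sub>R 0 + inverse \<tau> *\<^sub>R (\<tau> *\<^sub>R v)" using t by simp
    moreover have "0 < inverse \<tau>" "inverse \<tau> < 1" using t by (auto simp: inverse_less_1_iff)
    moreover have "0 \<noteq> \<tau> *\<^sub>R v" using v0 t by auto
    ultimately have "v \<in> open_segment 0 (\<tau> *\<^sub>R v)"
      unfolding in_segment by blast
    then show False using ext[OF assms(5) zP that] by blast
  qed
  define n where "n = v \<bullet> v"
  have n: "n > 0" using v0 by (simp add: n_def)
  have dec: "n *\<^sub>R x = (v \<bullet> x) *\<^sub>R v + cross v x *\<^sub>R rot v" for x
    by (simp add: vec_eq_2 n_def inner_2 cross_def algebra_simps)
  \<comment> \<open>With denominators cleared, the comparison of slopes is the inequality to be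
    proved.\<close>
  have ident: "n * (cross v w - cross v x - cross x w) = cross v w * (n - v \<bullet> x) - cross v x * (n - v \<bullet> w)" for x w
    by (simp add: n_def inner_2 cross_def algebra_simps)
  define A where "A = {x \<in> vertices P. cross v x > 0}"
  \<comment> \<open>Otherwise \<open>P\<close> would lie in a half-plane with the origin on its
    bounding line.\<close>
  have "A \<noteq> {}"
  proof
    assume "A = {}"
    then have "vertices P \<subseteq> {x. rot v \<bullet> x \<le> 0}" by (auto simp: A_def rot_inner)
    then have sub: "P \<subseteq> {x. rot v \<bullet> x \<le> 0}"
      using assms(3) hull_minimal[of "vertices P" "{x. rot v \<bullet> x \<le> 0}" convex] convex_halfspace_le by metis
    obtain e where e: "e > 0" "ball 0 e \<subseteq> P"
      using assms(4) by (auto simp: mem_interior)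
    have r: "norm (rot v) > 0" using v0 by (auto simp: vec_eq_2)
    have "(e / 2 / norm (rot v)) *\<^sub>R rot v \<in> ball 0 e" using e r by simp
    then have "rot v \<bullet> ((e / 2 / norm (rot v)) *\<^sub>R rot v) \<le> 0" using e sub by blast
    then have "rot v \<bullet> rot v \<le> 0" using e r by (simp add: mult_le_0_iff divide_le_0_iff)
    then show False using r by (metis inner_gt_zero_iff not_less zero_less_norm_iff)
  qed
  moreover have "finite A" using assms by (simp add: A_def)
  ultimately obtain w where w: "w \<in> A" and wmin: "\<And>x. x \<in> A \<Longrightarrow> (n - v \<bullet> w) / cross v w \<le> (n - v \<bullet> x) / cross v x"
    using ex_min_if_finite[of "(\<lambda>x. (n - v \<bullet> x) / cross v x) ` A"] by (auto simp: not_less)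
  have wV: "w \<in> vertices P" and wpos: "cross v w > 0" using w by (auto simp: A_def)
  have main: "cross v x + cross x w < cross v w" if x: "x \<in> vertices P" "x \<noteq> v" "x \<noteq> w" for x
  proof -
    have "cross v w * (n - v \<bullet> x) - cross v x * (n - v \<bullet> w) > 0"
    proof (cases "cross v x" "0 :: real" rule: linorder_cases)
      case less
      \<comment> \<open>Here \<open>x\<close> lies to the right of \<open>v\<close>, so the segment
        from \<open>x\<close> to \<open>w\<close> crosses the line of \<open>v\<close>, at
        \<open>\<tau> *\<^sub>R v\<close> and with parameter \<open>r\<close>. Extremality of
        \<open>v\<close> gives \<open>\<tau> < 1\<close>, which is the claim.\<close>
      define b where "b = cross v w - cross v x"
      have b: "b > 0" using less wpos by (simp add: b_def)
      define \<tau> where "\<tau> = (cross v w * (v \<bullet> x) - cross v x * (v \<bullet> w)) / (b * n)"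
      define r where "r = - cross v x / b"
      have "- cross v x < 1 * b" using wpos by (simp add: b_def)
      then have "r < 1" unfolding r_def pos_divide_less_eq[OF b] .
      moreover have "0 < r" unfolding r_def using less b by (intro divide_pos_pos) auto
      ultimately have r: "0 < r" "r < 1" by auto
      have "n *\<^sub>R ((1 - r) *\<^sub>R x + r *\<^sub>R w) = (1 - r) *\<^sub>R (n *\<^sub>R x) + r *\<^sub>R (n *\<^sub>R w)"
        by (simp add: algebra_simps)
      also have "\<dots> = ((1 - r) * (v \<bullet> x) + r * (v \<bullet> w)) *\<^sub>R v + ((1 - r) * cross v x + r * cross v w) *\<^sub>R rot v"
        unfolding dec by (simp add: algebra_simps)
      also have "(1 - r) * cross v x + r * cross v w = 0"
        using b by (simp add: r_def field_simps) (simp add: b_def algebra_simps)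
      also have "(1 - r) * (v \<bullet> x) + r * (v \<bullet> w) = n * \<tau>"
        using b n by (simp add: r_def \<tau>_def field_simps) (simp add: b_def algebra_simps)
      finally have z: "(1 - r) *\<^sub>R x + r *\<^sub>R w = \<tau> *\<^sub>R v" using n by (simp flip: scaleR_scaleR)
      have seg: "\<tau> *\<^sub>R v \<in> open_segment x w"
        using z r x unfolding in_segment by metis
      moreover have "open_segment x w \<subseteq> P"
        using assms(1) VP x wV by (meson convex_contains_open_segment)
      ultimately have "\<tau> \<le> 1" using shrink by blast
      moreover have "\<tau> \<noteq> 1" using seg ext[OF assms(5) VP VP, of x w] x wV by auto
      ultimately have "\<tau> < 1" by simp
      then have "cross v w * (v \<bullet> x) - cross v x * (v \<bullet> w) < b * n"
        using b n by (simp add: \<tau>_def)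
      then show ?thesis by (simp add: b_def algebra_simps)
    next
      case equal
      then have "n *\<^sub>R x = (v \<bullet> x) *\<^sub>R v" using dec[of x] by simp
      then have "inverse n *\<^sub>R (n *\<^sub>R x) = inverse n *\<^sub>R ((v \<bullet> x) *\<^sub>R v)" by simp
      then have e: "x = ((v \<bullet> x) / n) *\<^sub>R v" using n by (simp add: divide_inverse_commute)
      then have "((v \<bullet> x) / n) *\<^sub>R v \<in> P" using VP[OF x(1)] by simp
      then have "(v \<bullet> x) / n \<le> 1" by (rule shrink)
      moreover have "(v \<bullet> x) / n \<noteq> 1"
      proof
        assume "(v \<bullet> x) / n = 1"
        then show False using e x(2) by simp
      qed
      ultimately have "(v \<bullet> x) / n < 1" by linarith
      then show ?thesis using equal n wpos by (simp add: field_simps)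
    next
      case greater
      then have "x \<in> A" using x by (simp add: A_def)
      then have "cross v w * (n - v \<bullet> x) - cross v x * (n - v \<bullet> w) \<ge> 0"
        using wmin[of x] greater wpos by (simp add: field_simps)
      \<comment> \<open>Equal slopes would put \<open>v\<close>, \<open>w\<close>, \<open>x\<close>
        on one line; by the position \<open>r\<close> of \<open>x\<close> on it, one vertex would
        lie between two others or \<open>x\<close> would be \<open>w\<close>.\<close>
      moreover have "cross v w * (n - v \<bullet> x) \<noteq> cross v x * (n - v \<bullet> w)"
      proof
        assume e: "cross v w * (n - v \<bullet> x) = cross v x * (n - v \<bullet> w)"
        define r where "r = cross v x / cross v w"
        have r0: "r > 0" using greater wpos by (simp add: r_def)
        have vx: "v \<bullet> x = (1 - r) * n + r * (v \<bullet> w)"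
          using e wpos by (simp add: r_def field_simps)
        have cx: "cross v x = r * cross v w" using wpos by (simp add: r_def)
        have "n *\<^sub>R x = n *\<^sub>R ((1 - r) *\<^sub>R v + r *\<^sub>R w)"
        proof -
          have "n *\<^sub>R ((1 - r) *\<^sub>R v + r *\<^sub>R w) = ((1 - r) * n) *\<^sub>R v + r *\<^sub>R (n *\<^sub>R w)"
            by (simp add: algebra_simps)
          then show ?thesis unfolding dec vx cx by (simp add: algebra_simps)
        qed
        then have xe: "x = (1 - r) *\<^sub>R v + r *\<^sub>R w" using n by simp
        have vw: "v \<noteq> w" using wpos by auto
        consider "r < 1" | "r = 1" | "r > 1" by linarith
        then show False
        proof cases
          case 1
          then have "x \<in> open_segment v w" using xe r0 vw unfolding in_segment by metis
          then show False using ext[OF x(1) VP VP] assms(5) wV by blast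
        next
          case 2
          then show False using xe x by simp
        next
          case 3
          have "w = (1 - inverse r) *\<^sub>R v + inverse r *\<^sub>R x"
            unfolding xe using r0 by (simp add: algebra_simps)
          moreover have "0 < inverse r" "inverse r < 1" using 3 by (auto simp: inverse_less_1_iff)
          ultimately have "w \<in> open_segment v x" using x unfolding in_segment by metis
          then show False using ext[OF wV VP VP] assms(5) x by blast
        qed
      qed
      ultimately show ?thesis by linarith
    qed
    then have "n * (cross v w - cross v x - cross x w) > 0" unfolding ident .
    then show ?thesis using n by (simp add: zero_less_mult_iff)
  qed
  show ?thesis using that wV wpos main by blast
qed

lemma mem_triangle_0:
  "(x \<in> convex hull {0, a, b}) \<longleftrightarrow> (\<exists>s t. 0 \<le> s \<and> 0 \<le> t \<and> s + t \<le> 1 \<and> x = s *\<^sub>R a + t *\<^sub>R b)"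
  for a b x :: "real^2"
proof
  assume "x \<in> convex hull {0, a, b}"
  then obtain u s t where "0 \<le> u" "0 \<le> s" "0 \<le> t" "u + s + t = 1" "x = s *\<^sub>R a + t *\<^sub>R b"
    by (auto simp: convex_hull_3)
  then show "\<exists>s t. 0 \<le> s \<and> 0 \<le> t \<and> s + t \<le> 1 \<and> x = s *\<^sub>R a + t *\<^sub>R b"
    by (intro exI[of _ s] exI[of _ t]) auto
next
  assume "\<exists>s t. 0 \<le> s \<and> 0 \<le> t \<and> s + t \<le> 1 \<and> x = s *\<^sub>R a + t *\<^sub>R b"
  then obtain s t where "0 \<le> s" "0 \<le> t" "s + t \<le> 1" "x = s *\<^sub>R a + t *\<^sub>R b" by blast
  then have "x = (1 - s - t) *\<^sub>R 0 + s *\<^sub>R a + t *\<^sub>R b" "0 \<le> 1 - s - t" "1 - s - t + s + t = 1" by auto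
  then show "x \<in> convex hull {0, a, b}"
    unfolding convex_hull_3 using \<open>0 \<le> s\<close> \<open>0 \<le> t\<close> by blast
qed

lemma content_triangle_0: "measure lebesgue (convex hull {0, a, b}) = \<bar>cross a b\<bar> / 2" for a b :: "real^2"
proof -
  have "measure lebesgue (convex hull {0, a, b}) = measure lborel (convex hull {0, a, b})"
    by (simp add: measure_completion borel_compact finite_imp_compact_convex_hull)
  then show ?thesis
    by (simp add: content_triangle cross_def abs_minus_commute mult.commute)
qed

lemma triangle_lmeasurable: "convex hull {0, a, b} \<in> lmeasurable" for a b :: "real^2"
  by (simp add: lmeasurable_compact finite_imp_compact_convex_hull)

text \<open>The counterclockwise order is recorded by local data: a permutation and, for each edge,
  the fact that all other vertices lie strictly on the origin's side of its line
  (\<open>strict\<close>).\<close>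

locale polygon_cycle =
  fixes V :: "(real^2) set" and \<sigma> :: "real^2 \<Rightarrow> real^2"
  assumes finV: "finite V"
    and bij: "bij_betw \<sigma> V V"
    and pos: "v \<in> V \<Longrightarrow> cross v (\<sigma> v) > 0"
    and strict: "\<lbrakk>v \<in> V; x \<in> V; x \<noteq> v; x \<noteq> \<sigma> v\<rbrakk> \<Longrightarrow> cross v x + cross x (\<sigma> v) < cross v (\<sigma> v)"
    and zero: "0 \<in> convex hull V"

lemma polygon_cycle_vertices:
  fixes P :: "(real^2) set"
  assumes "polytope P" "0 \<in> interior P"
  obtains \<sigma> where "polygon_cycle (vertices P) \<sigma>" "P = convex hull (vertices P)"
proof -
  have fin: "finite (vertices P)"
    using finite_polyhedron_extreme_points[OF polytope_imp_polyhedron[OF assms(1)]]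
    by (simp add: vertices_def)
  have hull: "P = convex hull (vertices P)"
    unfolding vertices_def
    by (rule Krein_Milman_Minkowski) (use assms polytope_imp_compact polytope_imp_convex in auto)
  have conv: "convex P" using assms polytope_imp_convex by auto
  have "\<exists>w. w \<in> vertices P \<and> cross v w > 0 \<and> 
     (\<forall>x. x \<in> vertices P \<longrightarrow> x \<noteq> v \<longrightarrow> x \<noteq> w \<longrightarrow> cross v x + cross x w < cross v w)"
    if "v \<in> vertices P" for v
    using next_vertex[OF conv fin hull assms(2) that] by metis
  then obtain \<sigma> where s: "\<And>v. v \<in> vertices P \<Longrightarrow> \<sigma> v \<in> vertices P"
    "\<And>v. v \<in> vertices P \<Longrightarrow> cross v (\<sigma> v) > 0"
    "\<And>v x. \<lbrakk>v \<in> vertices P; x \<in> vertices P; x \<noteq> v; x \<noteq> \<sigma> v\<rbrakk> \<Longrightarrow> cross v x + cross x (\<sigma> v) < cross v (\<sigma> v)"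
    by metis
  \<comment> \<open>If two vertices had the same successor, \<open>strict\<close> would apply to
    each with the other as \<open>x\<close>; the two inequalities add up to
    \<open>0 < 0\<close>.\<close>
  have "inj_on \<sigma> (vertices P)"
  proof (rule inj_onI, rule ccontr)
    fix v v' assume a: "v \<in> vertices P" "v' \<in> vertices P" "\<sigma> v = \<sigma> v'" "v \<noteq> v'"
    have "v' \<noteq> \<sigma> v" "v \<noteq> \<sigma> v'" using s(2)[OF a(1)] s(2)[OF a(2)] a(3) by auto
    then show False using s(3)[OF a(1,2)] s(3)[OF a(2,1)] a cross_swap[of v v'] by simp
  qed
  moreover have "\<sigma> ` vertices P \<subseteq> vertices P" using s(1) by blast
  ultimately have "bij_betw \<sigma> (vertices P) (vertices P)"
    using fin by (simp add: bij_betw_def endo_inj_surj)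
  moreover have "0 \<in> convex hull (vertices P)" using hull assms(2) interior_subset by blast
  ultimately show ?thesis
    using fin s hull by (intro that[of \<sigma>]) (auto simp: polygon_cycle_def)
qed

context polygon_cycle begin

text \<open>The linear function with value 1 on the line of the edge from \<open>v\<close> to
  \<open>\<sigma> v\<close>. The maximum over all edges is the gauge of the polygon, that is
  \<open>- kappa\<close>.\<close>

definition ht :: "real^2 \<Rightarrow> real^2 \<Rightarrow> real" where
  "ht v x = (cross v x + cross x (\<sigma> v)) / cross v (\<sigma> v)"

text \<open>\<open>dv v\<close> is the vertex of the dual polygon that corresponds to the edge from \<open>v\<close> to \<open>\<sigma> v\<close>.\<close>

definition dv :: "real^2 \<Rightarrow> real^2" where
  "dv v = (1 / cross v (\<sigma> v)) *\<^sub>R rot (\<sigma> v - v)"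

lemma dv_inner: "dv v \<bullet> x = - ht v x"
  by (simp add: dv_def ht_def rot_inner cross_diff cross_swap[of x "\<sigma> v"] diff_divide_distrib add_divide_distrib)

lemma ht_linear: "ht v (a *\<^sub>R x + b *\<^sub>R y) = a * ht v x + b * ht v y"
  using dv_inner[of v "a *\<^sub>R x + b *\<^sub>R y"] dv_inner[of v x] dv_inner[of v y]
  by (simp add: inner_add_right)

lemma ht_0 [simp]: "ht v 0 = 0"
  by (simp add: ht_def)

lemma \<sigma>_in: "v \<in> V \<Longrightarrow> \<sigma> v \<in> V"
  using bij by (auto simp: bij_betw_def)

lemma \<sigma>_inj: "\<lbrakk>u \<in> V; v \<in> V; \<sigma> u = \<sigma> v\<rbrakk> \<Longrightarrow> u = v"
  using bij by (auto simp: bij_betw_def inj_on_def)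

lemma prev:
  assumes "v \<in> V" obtains u where "u \<in> V" "\<sigma> u = v"
  using bij assms by (metis bij_betw_def imageE)

lemma \<sigma>_neq: "v \<in> V \<Longrightarrow> \<sigma> v \<noteq> v" "v \<in> V \<Longrightarrow> \<sigma> (\<sigma> v) \<noteq> v"
  using pos[of v] pos[of "\<sigma> v"] \<sigma>_in[of v] cross_swap[of v "\<sigma> v"] by auto

lemma ht_1 [simp]: "v \<in> V \<Longrightarrow> ht v v = 1" "v \<in> V \<Longrightarrow> ht v (\<sigma> v) = 1"
  using pos[of v] by (simp_all add: ht_def)

lemma ht_less: "\<lbrakk>v \<in> V; x \<in> V; x \<noteq> v; x \<noteq> \<sigma> v\<rbrakk> \<Longrightarrow> ht v x < 1"
  using strict[of v x] pos[of v] by (simp add: ht_def)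

lemma ht_le: "\<lbrakk>v \<in> V; x \<in> V\<rbrakk> \<Longrightarrow> ht v x \<le> 1"
  using ht_less[of v x] ht_1[of v] by (cases "x = v"; cases "x = \<sigma> v") auto

lemma ht_next_less: "v \<in> V \<Longrightarrow> ht (\<sigma> v) v < 1"
  using ht_less[of "\<sigma> v" v] \<sigma>_in[of v] \<sigma>_neq[of v] by auto

lemma ht_prev_less: "v \<in> V \<Longrightarrow> ht v (\<sigma> (\<sigma> v)) < 1"
  using ht_less[of v "\<sigma> (\<sigma> v)"] \<sigma>_in[of v] \<sigma>_in[of "\<sigma> v"] \<sigma>_neq[of v] \<sigma>_neq[of "\<sigma> v"] by auto

lemma V_nonempty: "V \<noteq> {}"
  using zero by auto

lemma ht_max:
  obtains v where "v \<in> V" "\<And>v'. v' \<in> V \<Longrightarrow> ht v' x \<le> ht v x"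
proof -
  have "Max ((\<lambda>v. ht v x) ` V) \<in> (\<lambda>v. ht v x) ` V"
    using finV V_nonempty by (intro Max_in) auto
  then obtain v where v: "v \<in> V" "ht v x = Max ((\<lambda>v. ht v x) ` V)" by auto
  moreover have "ht v' x \<le> Max ((\<lambda>v. ht v x) ` V)" if "v' \<in> V" for v'
    using finV that by (intro Max_ge) auto
  ultimately show ?thesis using that by metis
qed

text \<open>Comparison with the two adjacent edges suffices: the preceding edge agrees with that of
  \<open>v\<close> on \<open>v\<close> and is lower on \<open>\<sigma> v\<close>, so maximality
  forces \<open>0 <= t\<close>; the following edge gives \<open>0 <= s\<close>.\<close>

lemma cone_coords:
  assumes "v \<in> V" "\<And>v'. v' \<in> V \<Longrightarrow> ht v' x \<le> ht v x"
  obtains s t where "0 \<le> s" "0 \<le> t" "x = s *\<^sub>R v + t *\<^sub>R \<sigma> v" "ht v x = s + t"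
proof -
  obtain s t where x: "x = s *\<^sub>R v + t *\<^sub>R \<sigma> v"
    using cross_basis[of v "\<sigma> v" x] pos[OF assms(1)] by auto
  have h: "ht v x = s + t" using assms(1) by (simp add: x ht_linear)
  obtain u where u: "u \<in> V" "\<sigma> u = v" using prev assms by blast
  have "ht u x = s + t * ht u (\<sigma> v)" using ht_1[OF u(1)] u by (simp add: x ht_linear)
  then have "0 \<le> t * (1 - ht u (\<sigma> v))" using assms(2)[OF u(1)] h by (simp add: algebra_simps)
  then have "0 \<le> t" using ht_prev_less[OF u(1)] u by (simp add: zero_le_mult_iff)
  moreover have "ht (\<sigma> v) x = s * ht (\<sigma> v) v + t" using \<sigma>_in assms(1) by (simp add: x ht_linear)
  then have "0 \<le> s * (1 - ht (\<sigma> v) v)" using assms(2)[OF \<sigma>_in[OF assms(1)]] h by (simp add: algebra_simps)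
  then have "0 \<le> s" using ht_next_less[OF assms(1)] by (simp add: zero_le_mult_iff)
  ultimately show ?thesis using that x h by blast
qed

lemma cone_max:
  assumes "v \<in> V" "0 \<le> s" "0 \<le> t" "v' \<in> V"
  shows "ht v' (s *\<^sub>R v + t *\<^sub>R \<sigma> v) \<le> s + t"
  using mult_left_mono[OF ht_le[OF assms(4,1)] assms(2)]
    mult_left_mono[OF ht_le[OF assms(4) \<sigma>_in[OF assms(1)]] assms(3)]
  by (simp add: ht_linear)

text \<open>A different edge contains at most one of \<open>v\<close> and \<open>\<sigma> v\<close>,
  so one of the two terms is strictly smaller.\<close>

lemma cone_interior_max:
  assumes "v \<in> V" "0 < s" "0 < t" "v' \<in> V" "v' \<noteq> v"
  shows "ht v' (s *\<^sub>R v + t *\<^sub>R \<sigma> v) < s + t"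
proof (cases "ht v' v < 1")
  case True
  then show ?thesis
    using mult_strict_left_mono[OF True assms(2)] assms ht_le[OF assms(4) \<sigma>_in[OF assms(1)]]
    by (simp add: ht_linear add_less_le_mono)
next
  case False
  then have "v = \<sigma> v'" using ht_less[of v' v] assms by auto
  then have "ht v' (\<sigma> v) < 1" using ht_prev_less[OF assms(4)] by simp
  from mult_strict_left_mono[OF this assms(3)] show ?thesis
    using assms ht_le[OF assms(4,1)] by (simp add: ht_linear add_le_less_mono)
qed

lemma cone_interior_unique:
  assumes "v \<in> V" "0 < s" "0 < t" "v' \<in> V" "0 < s'" "0 < t'"
    "s *\<^sub>R v + t *\<^sub>R \<sigma> v = s' *\<^sub>R v' + t' *\<^sub>R \<sigma> v'"
  shows "v = v'"
proof (rule ccontr)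
  assume "v \<noteq> v'"
  then have "ht v' (s *\<^sub>R v + t *\<^sub>R \<sigma> v) < s + t" "ht v (s' *\<^sub>R v' + t' *\<^sub>R \<sigma> v') < s' + t'"
    by (auto intro: cone_interior_max[OF assms(1-4)] cone_interior_max[OF assms(4-6,1)])
  moreover have "ht v (s *\<^sub>R v + t *\<^sub>R \<sigma> v) = s + t" "ht v' (s' *\<^sub>R v' + t' *\<^sub>R \<sigma> v') = s' + t'"
    using assms(1,4) by (simp_all add: ht_linear)
  ultimately show False using assms(7) by simp
qed

text \<open>For the harder inclusion, \<open>x\<close> lies in the cone over an edge where its
  height is largest, with coordinates of sum at most 1, hence in the triangle over that
  edge.\<close>

lemma hull_eq: "convex hull V = {x. \<forall>v\<in>V. ht v x \<le> 1}"
proof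
  have "convex {x. \<forall>v\<in>V. ht v x \<le> 1}"
  proof -
    have "{x. \<forall>v\<in>V. ht v x \<le> 1} = (\<Inter>v\<in>V. {x. dv v \<bullet> x \<ge> -1})"
      by (auto simp: dv_inner)
    then show ?thesis by (simp add: convex_INT convex_halfspace_ge)
  qed
  then show "convex hull V \<subseteq> {x. \<forall>v\<in>V. ht v x \<le> 1}"
    by (intro hull_minimal) (auto simp: ht_le)
  show "{x. \<forall>v\<in>V. ht v x \<le> 1} \<subseteq> convex hull V"
  proof
    fix x assume x: "x \<in> {x. \<forall>v\<in>V. ht v x \<le> 1}"
    obtain v where v: "v \<in> V" "\<And>v'. v' \<in> V \<Longrightarrow> ht v' x \<le> ht v x" using ht_max[of x] by blast
    obtain s t where st: "0 \<le> s" "0 \<le> t" "x = s *\<^sub>R v + t *\<^sub>R \<sigma> v" "ht v x = s + t"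
      using cone_coords[OF v] by blast
    have "x \<in> convex hull {0, v, \<sigma> v}" unfolding mem_triangle_0
      by (intro exI[of _ s] exI[of _ t]) (use x v st in auto)
    moreover have "convex hull {0, v, \<sigma> v} \<subseteq> convex hull V"
      using hull_inc[OF v(1)] hull_inc[OF \<sigma>_in[OF v(1)]] zero by (intro hull_minimal) auto
    ultimately show "x \<in> convex hull V" by blast
  qed
qed

lemma triangle_eq:
  assumes "v \<in> V"
  shows "convex hull {0, v, \<sigma> v} = {x. (\<forall>v'\<in>V. ht v' x \<le> ht v x) \<and> ht v x \<le> 1}"
proof safe
  fix x assume "x \<in> convex hull {0, v, \<sigma> v}"
  then obtain s t where st: "0 \<le> s" "0 \<le> t" "s + t \<le> 1" "x = s *\<^sub>R v + t *\<^sub>R \<sigma> v"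
    by (auto simp: mem_triangle_0)
  then have h: "ht v x = s + t" using assms by (simp add: ht_linear)
  then show "ht v x \<le> 1" using st by simp
  show "ht v' x \<le> ht v x" if "v' \<in> V" for v'
    using cone_max[OF assms st(1,2) that] st h by simp
next
  fix x assume x: "\<forall>v'\<in>V. ht v' x \<le> ht v x" "ht v x \<le> 1"
  obtain s t where "0 \<le> s" "0 \<le> t" "x = s *\<^sub>R v + t *\<^sub>R \<sigma> v" "ht v x = s + t"
    using cone_coords[OF assms, of x] x by blast
  then show "x \<in> convex hull {0, v, \<sigma> v}" using x unfolding mem_triangle_0 by (metis)
qed

lemma hull_eq_triangles: "convex hull V = (\<Union>v\<in>V. convex hull {0, v, \<sigma> v})"
proof safe
  fix x assume x: "x \<in> convex hull V"
  obtain v where v: "v \<in> V" "\<And>v'. v' \<in> V \<Longrightarrow> ht v' x \<le> ht v x" using ht_max[of x] by blast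
  then show "x \<in> (\<Union>v\<in>V. convex hull {0, v, \<sigma> v})"
    using x by (auto simp: triangle_eq hull_eq)
next
  fix x v assume "v \<in> V" "x \<in> convex hull {0, v, \<sigma> v}"
  then show "x \<in> convex hull V" by (force simp: triangle_eq hull_eq)
qed

lemma dv_inj:
  assumes "v \<in> V" "v' \<in> V" "dv v = dv v'"
  shows "v = v'"
proof (rule ccontr)
  assume n: "v \<noteq> v'"
  have e: "ht v x = ht v' x" for x using dv_inner[of v x] dv_inner[of v' x] assms by simp
  have "ht v v' = 1" "ht v (\<sigma> v') = 1" using assms by (simp_all add: e)
  then have "v' = \<sigma> v" "\<sigma> v' = v \<or> \<sigma> v' = \<sigma> v"
    using ht_less[OF assms(1,2)] ht_less[OF assms(1) \<sigma>_in[OF assms(2)]] n by auto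
  then show False using \<sigma>_neq assms \<sigma>_in by metis
qed

text \<open>Two triangles of the fan overlap only where two different linear functions
  \<open>ht\<close> agree, which is a line and has measure 0.\<close>

lemma area_hull: "measure lebesgue (convex hull V) = (\<Sum>v\<in>V. cross v (\<sigma> v)) / 2"
proof -
  have "measure lebesgue (convex hull V) = (\<Sum>v\<in>V. measure lebesgue (convex hull {0, v, \<sigma> v}))"
    unfolding hull_eq_triangles
  proof (rule measure_negligible_finite_Union_image[OF finV])
    show "pairwise (\<lambda>x y. negligible (convex hull {0, x, \<sigma> x} \<inter> convex hull {0, y, \<sigma> y})) V"
    proof (rule pairwiseI)
      fix v v' assume v: "v \<in> V" "v' \<in> V" "v \<noteq> v'"
      have "convex hull {0, v, \<sigma> v} \<inter> convex hull {0, v', \<sigma> v'} \<subseteq> {x. (dv v - dv v') \<bullet> x = 0}"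
        using v by (auto simp: triangle_eq inner_diff_left dv_inner intro: antisym)
      moreover have "negligible {x. (dv v - dv v') \<bullet> x = 0}"
        using dv_inj v by (intro negligible_hyperplane) auto
      ultimately show "negligible (convex hull {0, v, \<sigma> v} \<inter> convex hull {0, v', \<sigma> v'})"
        by (rule negligible_subset[rotated])
    qed
  qed (rule triangle_lmeasurable)
  also have "\<dots> = (\<Sum>v\<in>V. cross v (\<sigma> v)) / 2"
    unfolding content_triangle_0 sum_divide_distrib
    using pos by (intro sum.cong refl) (simp add: less_imp_le)
  finally show ?thesis .
qed

lemma kappa_eq:
  assumes "v \<in> V" "\<And>v'. v' \<in> V \<Longrightarrow> ht v' x \<le> ht v x"
  shows "kappa (convex hull V) x = - ht v x"
proof -
  obtain s t where st: "0 \<le> s" "0 \<le> t" "x = s *\<^sub>R v + t *\<^sub>R \<sigma> v" "ht v x = s + t"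
    using cone_coords[OF assms] by blast
  have "(LEAST c::real. c \<ge> 0 \<and> x \<in> (*\<^sub>R) c ` (convex hull V)) = ht v x"
  proof (rule Least_equality)
    show "0 \<le> ht v x \<and> x \<in> (*\<^sub>R) (ht v x) ` (convex hull V)"
    \<comment> \<open>The factor 0 is attained only by the origin; any other point is scaled back by
      the inverse of its height.\<close>
    proof (cases "ht v x = 0")
      case True
      then have "x = 0" using st by (simp add: add_nonneg_eq_0_iff)
      then show ?thesis using zero True by auto
    next
      case False
      then have p: "ht v x > 0" using st by simp
      have "inverse (ht v x) *\<^sub>R x \<in> convex hull V"
        unfolding hull_eq
      proof safe
        fix v' assume "v' \<in> V"
        then have "ht v' x \<le> ht v x" by (rule assms)
        moreover have "ht v' (inverse (ht v x) *\<^sub>R x) = inverse (ht v x) * ht v' x"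
          using ht_linear[of v' _ x 0 0] by simp
        ultimately have "ht v' (inverse (ht v x) *\<^sub>R x) \<le> inverse (ht v x) * ht v x"
          using p by (metis inverse_nonnegative_iff_nonnegative less_imp_le mult_left_mono)
        then show "ht v' (inverse (ht v x) *\<^sub>R x) \<le> 1" using p by simp
      qed
      moreover have "x = ht v x *\<^sub>R (inverse (ht v x) *\<^sub>R x)" using p by simp
      ultimately show ?thesis using p by (metis imageI less_imp_le)
    qed
  next
    fix c :: real assume c: "0 \<le> c \<and> x \<in> (*\<^sub>R) c ` (convex hull V)"
    then obtain p where p: "p \<in> convex hull V" "x = c *\<^sub>R p" by auto
    then have "ht v x = c * ht v p" using ht_linear[of v c p 0 0] by simp
    moreover have "ht v p \<le> 1" using p assms(1) by (simp add: hull_eq)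
    ultimately show "ht v x \<le> c" using c by (simp add: mult_left_le)
  qed
  then show ?thesis by (simp add: kappa_def)
qed

section \<open>The dual polygon and its fan of triangles\<close>

lemma dual_eq: "dual_polygon (convex hull V) = {y. \<forall>v\<in>V. y \<bullet> v \<ge> -1}"
proof safe
  fix y v assume "y \<in> dual_polygon (convex hull V)" "v \<in> V"
  then show "-1 \<le> y \<bullet> v" by (auto simp: dual_polygon_def hull_inc)
next
  fix y assume "\<forall>v\<in>V. y \<bullet> v \<ge> -1"
  then have "convex hull V \<subseteq> {x. y \<bullet> x \<ge> -1}"
    by (intro hull_minimal) (auto simp: convex_halfspace_ge)
  then show "y \<in> dual_polygon (convex hull V)" by (auto simp: dual_polygon_def)
qed

lemma cross_dv:
  assumes "v \<in> V"
  shows "cross (dv v) (dv (\<sigma> v)) = 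
     (cross v (\<sigma> v) + cross (\<sigma> v) (\<sigma> (\<sigma> v)) - cross v (\<sigma> (\<sigma> v))) / (cross v (\<sigma> v) * cross (\<sigma> v) (\<sigma> (\<sigma> v)))"
proof -
  have "cross (rot x) (rot y) = cross x y" for x y by (simp add: cross_def)
  then show ?thesis by (simp add: dv_def cross_scale cross_diff add_ac mult_ac diff_diff_eq2)
qed

text \<open>The numerator in \<open>cross_dv\<close> is positive because \<open>v\<close> lies
  strictly inside the line of the edge that follows its own.\<close>

lemma cross_dv_pos:
  assumes "v \<in> V"
  shows "cross (dv v) (dv (\<sigma> v)) > 0"
proof -
  have "cross (\<sigma> v) v + cross v (\<sigma> (\<sigma> v)) < cross (\<sigma> v) (\<sigma> (\<sigma> v))"
    using strict[of "\<sigma> v" v] assms \<sigma>_in[of v] \<sigma>_neq[of v] by auto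
  then show ?thesis
    unfolding cross_dv[OF assms] using pos[OF assms] pos[OF \<sigma>_in[OF assms]] cross_swap[of v "\<sigma> v"]
    by (intro divide_pos_pos mult_pos_pos) auto
qed

text \<open>\<open>\<sigma> v\<close> lies on both edges involved, so the side from
  \<open>dv v\<close> to \<open>dv (\<sigma> v)\<close> is dual to it: over this side,
  \<open>\<sigma> v\<close> has the smallest pairing with \<open>y\<close> among all
  vertices.\<close>

lemma dual_triangle_eq:
  assumes "v \<in> V"
  shows "convex hull {0, dv v, dv (\<sigma> v)} = {y. (\<forall>x\<in>V. y \<bullet> \<sigma> v \<le> y \<bullet> x) \<and> y \<bullet> \<sigma> v \<ge> -1}"
proof safe
  have w: "\<sigma> v \<in> V" using assms \<sigma>_in by blast
  fix y assume "y \<in> convex hull {0, dv v, dv (\<sigma> v)}"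
  then obtain s t where st: "0 \<le> s" "0 \<le> t" "s + t \<le> 1" "y = s *\<^sub>R dv v + t *\<^sub>R dv (\<sigma> v)"
    by (auto simp: mem_triangle_0)
  have h: "y \<bullet> \<sigma> v = - s - t" using assms w by (simp add: st inner_add_left dv_inner)
  then show "-1 \<le> y \<bullet> \<sigma> v" using st by simp
  fix x assume x: "x \<in> V"
  have "s * ht v x \<le> s" "t * ht (\<sigma> v) x \<le> t"
    using st x assms w ht_le by (auto intro: mult_left_le)
  then show "y \<bullet> \<sigma> v \<le> y \<bullet> x" by (simp add: h) (simp add: st inner_add_left dv_inner)
next
  have w: "\<sigma> v \<in> V" using assms \<sigma>_in by blast
  have z: "\<sigma> (\<sigma> v) \<in> V" using w \<sigma>_in by blast
  fix y assume y: "\<forall>x\<in>V. y \<bullet> \<sigma> v \<le> y \<bullet> x" "-1 \<le> y \<bullet> \<sigma> v"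
  obtain s t where e: "y = s *\<^sub>R dv v + t *\<^sub>R dv (\<sigma> v)"
    using cross_basis[of "dv v" "dv (\<sigma> v)" y] cross_dv_pos[OF assms] by auto
  have h: "y \<bullet> \<sigma> v = - s - t" using assms w by (simp add: e inner_add_left dv_inner)
  have "y \<bullet> v = - s - t * ht (\<sigma> v) v" using assms by (simp add: e inner_add_left dv_inner)
  then have "0 \<le> t * (1 - ht (\<sigma> v) v)" using y(1) assms h by (force simp: algebra_simps)
  then have t: "0 \<le> t" using ht_next_less[OF assms] by (simp add: zero_le_mult_iff)
  have "y \<bullet> \<sigma> (\<sigma> v) = - s * ht v (\<sigma> (\<sigma> v)) - t" using w by (simp add: e inner_add_left dv_inner)
  then have "0 \<le> s * (1 - ht v (\<sigma> (\<sigma> v)))" using y(1) z h by (force simp: algebra_simps)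
  then have s: "0 \<le> s" using ht_prev_less[OF assms] by (simp add: zero_le_mult_iff)
  show "y \<in> convex hull {0, dv v, dv (\<sigma> v)}"
    unfolding mem_triangle_0 using s t e h y(2) by (intro exI[of _ s] exI[of _ t]) auto
qed

lemma dual_eq_triangles: "dual_polygon (convex hull V) = (\<Union>v\<in>V. convex hull {0, dv v, dv (\<sigma> v)})"
proof safe
  fix y assume y: "y \<in> dual_polygon (convex hull V)"
  have "Min ((\<bullet>) y ` V) \<in> (\<bullet>) y ` V" using finV V_nonempty by (intro Min_in) auto
  then obtain w where w: "w \<in> V" "y \<bullet> w = Min ((\<bullet>) y ` V)" by auto
  have "y \<bullet> w \<le> y \<bullet> x" if "x \<in> V" for x
    unfolding w(2) using finV that by (intro Min_le) auto
  moreover obtain v where "v \<in> V" "\<sigma> v = w" using prev[OF w(1)] .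
  ultimately show "y \<in> (\<Union>v\<in>V. convex hull {0, dv v, dv (\<sigma> v)})"
    using y w(1) by (auto simp: dual_triangle_eq dual_eq)
next
  fix y v assume "v \<in> V" "y \<in> convex hull {0, dv v, dv (\<sigma> v)}"
  then show "y \<in> dual_polygon (convex hull V)" by (force simp: dual_triangle_eq dual_eq)
qed

lemma area_dual: "measure lebesgue (dual_polygon (convex hull V)) = (\<Sum>v\<in>V. cross (dv v) (dv (\<sigma> v))) / 2"
proof -
  have "measure lebesgue (dual_polygon (convex hull V)) = (\<Sum>v\<in>V. measure lebesgue (convex hull {0, dv v, dv (\<sigma> v)}))"
    unfolding dual_eq_triangles
  proof (rule measure_negligible_finite_Union_image[OF finV])
    show "pairwise (\<lambda>x y. negligible (convex hull {0, dv x, dv (\<sigma> x)} \<inter> convex hull {0, dv y, dv (\<sigma> y)})) V"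
    proof (rule pairwiseI)
      fix v v' assume v: "v \<in> V" "v' \<in> V" "v \<noteq> v'"
      have "convex hull {0, dv v, dv (\<sigma> v)} \<inter> convex hull {0, dv v', dv (\<sigma> v')} \<subseteq> {y. (\<sigma> v - \<sigma> v') \<bullet> y = 0}"
      proof
        fix y assume "y \<in> convex hull {0, dv v, dv (\<sigma> v)} \<inter> convex hull {0, dv v', dv (\<sigma> v')}"
        then have "\<forall>x\<in>V. y \<bullet> \<sigma> v \<le> y \<bullet> x" "\<forall>x\<in>V. y \<bullet> \<sigma> v' \<le> y \<bullet> x"
          unfolding dual_triangle_eq[OF v(1)] dual_triangle_eq[OF v(2)] by blast+
        then have "y \<bullet> \<sigma> v = y \<bullet> \<sigma> v'"
          using \<sigma>_in v by (meson antisym)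
        then show "y \<in> {y. (\<sigma> v - \<sigma> v') \<bullet> y = 0}"
          by (simp add: inner_diff_left inner_commute[of "\<sigma> _"])
      qed
      moreover have "negligible {y. (\<sigma> v - \<sigma> v') \<bullet> y = 0}"
        using \<sigma>_inj v by (intro negligible_hyperplane) auto
      ultimately show "negligible (convex hull {0, dv v, dv (\<sigma> v)} \<inter> convex hull {0, dv v', dv (\<sigma> v')})"
        by (rule negligible_subset[rotated])
    qed
  qed (rule triangle_lmeasurable)
  also have "\<dots> = (\<Sum>v\<in>V. cross (dv v) (dv (\<sigma> v))) / 2"
    unfolding content_triangle_0 sum_divide_distrib
    using cross_dv_pos by (intro sum.cong refl) (simp add: less_imp_le)
  finally show ?thesis .
qed

text \<open>A separating vector \<open>a\<close> would have negative height for every edge, but its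
  largest height is a sum of two nonnegative coordinates.\<close>

lemma zero_in_hull_dv: "0 \<in> convex hull (dv ` V)"
proof (rule ccontr)
  assume "0 \<notin> convex hull (dv ` V)"
  moreover have "closed (convex hull (dv ` V))"
    using finV by (intro compact_imp_closed finite_imp_compact_convex_hull) auto
  ultimately obtain a b where ab: "a \<bullet> 0 < b" "\<And>x. x \<in> convex hull (dv ` V) \<Longrightarrow> b < a \<bullet> x"
    using separating_hyperplane_closed_point[of "convex hull (dv ` V)" 0] convex_convex_hull by metis
  have neg: "ht v a < 0" if "v \<in> V" for v
    using ab(1) ab(2)[OF hull_inc[of "dv v"]] that dv_inner[of v a] by (simp add: inner_commute)
  obtain v where v: "v \<in> V" "\<And>v'. v' \<in> V \<Longrightarrow> ht v' a \<le> ht v a" using ht_max[of a] by blast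
  obtain s t where "0 \<le> s" "0 \<le> t" "ht v a = s + t" using cone_coords[OF v] by metis
  then show False using neg[OF v(1)] by simp
qed

lemma dv_in_dual: "v \<in> V \<Longrightarrow> dv v \<in> dual_polygon (convex hull V)"
  by (simp add: dual_eq dv_inner ht_le)

lemma dual_eq_hull: "dual_polygon (convex hull V) = convex hull (dv ` V)"
proof
  show "dual_polygon (convex hull V) \<subseteq> convex hull (dv ` V)"
    unfolding dual_eq_triangles
    by (intro UN_least hull_minimal) (auto intro: zero_in_hull_dv hull_inc \<sigma>_in)
  have "convex (dual_polygon (convex hull V))"
  proof -
    have "dual_polygon (convex hull V) = (\<Inter>v\<in>V. {y. v \<bullet> y \<ge> -1})"
      by (auto simp: dual_eq inner_commute)
    then show ?thesis by (simp add: convex_INT convex_halfspace_ge)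
  qed
  then show "convex hull (dv ` V) \<subseteq> dual_polygon (convex hull V)"
    by (intro hull_minimal) (auto simp: dv_in_dual)
qed

text \<open>The constraints of \<open>v\<close> and \<open>\<sigma> v\<close> are tight at
  \<open>dv v\<close>, hence at both ends of a segment through it; as \<open>v\<close> and
  \<open>\<sigma> v\<close> span the plane, the ends coincide.\<close>

lemma dv_vertex:
  assumes "v \<in> V"
  shows "dv v \<in> vertices (dual_polygon (convex hull V))"
  unfolding vertices_def mem_Collect_eq extreme_point_of_def
proof (intro conjI ballI notI)
  show "dv v \<in> dual_polygon (convex hull V)" using assms by (rule dv_in_dual)
  fix a b assume ab: "a \<in> dual_polygon (convex hull V)" "b \<in> dual_polygon (convex hull V)" "dv v \<in> open_segment a b"
  then obtain u where u: "0 < u" "u < 1" "dv v = (1 - u) *\<^sub>R a + u *\<^sub>R b" "a \<noteq> b"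
    by (auto simp: in_segment)
  have tight: "a \<bullet> x = -1" "b \<bullet> x = -1" if "x \<in> V" "ht v x = 1" for x
  proof -
    have 1: "a \<bullet> x \<ge> -1" "b \<bullet> x \<ge> -1" using ab that by (auto simp: dual_eq)
    have "(1 - u) * (a \<bullet> x + 1) + u * (b \<bullet> x + 1) = 0"
      using dv_inner[of v x] that by (simp add: u(3) inner_add_left algebra_simps)
    moreover have "(1 - u) * (a \<bullet> x + 1) \<ge> 0" "u * (b \<bullet> x + 1) \<ge> 0" using u 1 by auto
    ultimately have "(1 - u) * (a \<bullet> x + 1) = 0" "u * (b \<bullet> x + 1) = 0" by linarith+
    then show "a \<bullet> x = -1" "b \<bullet> x = -1" using u by auto
  qed
  have "(a - b) \<bullet> v = 0" "(a - b) \<bullet> \<sigma> v = 0"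
    using tight[OF assms] tight[OF \<sigma>_in[OF assms]] assms by (simp_all add: inner_diff_left)
  then have "(a - b) \<bullet> x = 0" for x
    using cross_basis[of v "\<sigma> v" x] pos[OF assms]
    by (metis add.right_neutral inner_add_right inner_scaleR_right less_irrefl mult_zero_right)
  then have "a = b" by (metis eq_iff_diff_eq_0 inner_eq_zero_iff)
  then show False using u by simp
qed

lemma dual_interior: "0 \<in> interior (dual_polygon (convex hull V))"
proof -
  obtain B where B: "B > 0" "\<And>v. v \<in> V \<Longrightarrow> norm v \<le> B"
    using finite_imp_bounded[OF finV] unfolding bounded_pos by blast
  have "ball 0 (1 / B) \<subseteq> dual_polygon (convex hull V)"
    unfolding dual_eq
  proof safe
    fix y v assume y: "y \<in> ball (0 :: real^2) (1 / B)" "v \<in> V"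
    have "\<bar>y \<bullet> v\<bar> \<le> norm y * norm v" by (rule Cauchy_Schwarz_ineq2)
    also have "\<dots> \<le> 1 / B * B" using y B by (intro mult_mono) auto
    finally show "-1 \<le> y \<bullet> v" using B by simp
  qed
  then show ?thesis using B by (auto simp: mem_interior intro!: exI[of _ "1 / B"])
qed

lemma dual_is_polygon: "polygon (dual_polygon (convex hull V))"
  unfolding polygon_def
proof
  show "polytope (dual_polygon (convex hull V))"
    unfolding dual_eq_hull polytope_def using finV by blast
  show "aff_dim (dual_polygon (convex hull V)) = 2"
    using aff_dim_nonempty_interior[of "dual_polygon (convex hull V)"] dual_interior by auto
qed

end

section \<open>Lattices in the plane\<close>

lemma sum_sawtooth_squares:
  fixes d :: int
  assumes "d > 0"
  shows "(\<Sum>j\<in>{1..<d}. (of_int j / of_int d - 1/2 :: real)\<^sup>2) = (of_int d - 1) * (of_int d - 2) / (12 * of_int d)"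
proof -
  define D where "D = real_of_int d"
  have D: "D > 0" using assms by (simp add: D_def)
  have d1: "1 \<le> d" using assms by simp
  have "(\<Sum>j\<in>{1..<d}. (of_int j / D - 1/2)\<^sup>2) = (\<Sum>j\<in>{1..<d}. (1 / D\<^sup>2) * (of_int j)\<^sup>2 - (1 / D) * of_int j + 1/4)"
    using D by (intro sum.cong refl) (simp add: power2_eq_square field_simps)
  also have "\<dots> = (1 / D\<^sup>2) * (D * (D - 1) * (2 * D - 1) / 6) - (1 / D) * (D * (D - 1) / 2) + (D - 1) / 4"
    unfolding sum.distrib sum_subtractf sum_distrib_left[symmetric] sum_int_interval[OF d1]
      sum_squares_int_interval[OF d1] using d1 by (simp add: D_def)
  also have "\<dots> = (D - 1) * (D - 2) / (12 * D)"
    using D by (simp add: field_simps power2_eq_square)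
  finally show ?thesis by (simp add: D_def)
qed

text \<open>The sum over the whole fundamental parallelogram is a Dedekind sum, and the point reflection of the
  parallelogram shows that each of its two halves contributes the same amount.\<close>

lemma triangle_sum_mod:
  fixes h d :: int
  assumes "coprime h d" "d > 0"
  shows "(\<Sum>j | j \<in> {1..<d} \<and> j + h * j mod d < d. (1 - of_int (j + h * j mod d) / of_int d)\<^sup>2)
    = (of_int d - 1) * (of_int d - 2) / (12 * of_int d) + dsum h d"
proof -
  define r where "r j = h * j mod d" for j
  define f where "f j = (1 - of_int (j + r j) / of_int d :: real)\<^sup>2" for j
  have r: "r (d - j) = d - r j" "r j \<in> {1..<d}" if "j \<in> {1..<d}" for j
  proof -
    show rj: "r j \<in> {1..<d}" unfolding r_def using mult_mod_pos[OF assms(1) that] .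
    have "h * (d - j) = - (h * j) + h * d" by (simp add: algebra_simps)
    then have "r (d - j) = (- (h * j)) mod d" unfolding r_def by (simp only: mod_mult_self1)
    also have "\<dots> = d - r j" using rj unfolding r_def by (simp add: zmod_zminus1_eq_if)
    finally show "r (d - j) = d - r j" .
  qed
  define J1 J2 J3 where "J1 = {j. j \<in> {1..<d} \<and> j + r j < d}" and "J2 = {j. j \<in> {1..<d} \<and> j + r j > d}"
    and "J3 = {j. j \<in> {1..<d} \<and> j + r j = d}"
  \<comment> \<open>The point reflection sends \<open>j\<close> to \<open>d - j\<close> and its
    remainder to \<open>d - r j\<close>. Points of \<open>J3\<close>, on the diagonal, contribute
    0.\<close>
  have "bij_betw (\<lambda>j. d - j) J1 J2"
    by (rule bij_betwI[of _ _ _ "\<lambda>j. d - j"]) (auto simp: J1_def J2_def r)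
  then have "sum f J2 = (\<Sum>j\<in>J1. f (d - j))"
    by (rule sum.reindex_bij_betw[symmetric])
  also have "\<dots> = sum f J1"
  proof (intro sum.cong refl)
    fix j assume "j \<in> J1"
    then have "r (d - j) = d - r j" using r by (simp add: J1_def)
    then have e: "d - j + r (d - j) = 2 * d - (j + r j)" by simp
    have "1 - of_int (d - j + r (d - j)) / of_int d = - (1 - of_int (j + r j) / of_int d :: real)"
      unfolding e using assms(2) by (simp add: field_simps)
    then show "f (d - j) = f j" unfolding f_def by (metis power2_minus)
  qed
  finally have J2: "sum f J2 = sum f J1" .
  have J3: "sum f J3 = 0"
    using assms by (intro sum.neutral) (auto simp: J3_def f_def)
  have "{1..<d} = J1 \<union> (J2 \<union> J3)" "J1 \<inter> (J2 \<union> J3) = {}" "J2 \<inter> J3 = {}"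
    by (auto simp: J1_def J2_def J3_def)
  moreover have "finite J1" "finite J2" "finite J3"
    unfolding J1_def J2_def J3_def by (rule finite_subset[of _ "{1..<d}"]; auto)+
  ultimately have tot: "sum f {1..<d} = 2 * sum f J1"
    using J2 J3 by (simp add: sum.union_disjoint)
  \<comment> \<open>Up to sign, \<open>1 - (j + r j) / d\<close> is the sum of the two sawtooth
    values. The mixed products give the Dedekind sum, and the two sums of squares agree since
    \<open>r\<close> permutes the range.\<close>
  have "sum f {1..<d} = (\<Sum>j\<in>{1..<d}. (of_int j / of_int d - 1/2)\<^sup>2 + (of_int (r j) / of_int d - 1/2)\<^sup>2
      + 2 * ((of_int j / of_int d - 1/2) * (of_int (r j) / of_int d - 1/2)))"
    unfolding f_def by (intro sum.cong refl) (simp add: power2_eq_square add_divide_distrib algebra_simps)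
  also have "\<dots> = 2 * ((of_int d - 1) * (of_int d - 2) / (12 * of_int d)) + 2 * dsum h d"
  proof -
    have "(\<Sum>j\<in>{1..<d}. (of_int (r j) / of_int d - 1/2 :: real)\<^sup>2) = (\<Sum>j\<in>{1..<d}. (of_int j / of_int d - 1/2)\<^sup>2)"
      unfolding r_def by (rule sum.reindex_bij_betw[OF bij_betw_mult_mod[OF assms(1)]])
    then show ?thesis
      unfolding sum.distrib sum_distrib_left[symmetric] dsum_def r_def
      using sum_sawtooth_squares[OF assms(2)] by simp
  qed
  finally show ?thesis using tot unfolding J1_def f_def r_def by simp
qed

text \<open>The points of \<open>I\<close> are parametrized by \<open>j = idet x z\<close>: the
  other coordinate \<open>idet z y\<close> is congruent to \<open>h * j\<close> modulo
  \<open>d\<close>, and the bounds make it the remainder.\<close>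

lemma triangle_sum:
  assumes "iprim x" "iprim y" "idet x y > 0"
  defines "d \<equiv> idet x y"
  shows "(\<Sum>z | 0 < idet x z \<and> 0 < idet z y \<and> idet x z + idet z y < d. (1 - of_int (idet x z + idet z y) / of_int d)\<^sup>2)
    = (of_int d - 1) * (of_int d - 2) / (12 * of_int d) + dpair x y"
proof -
  obtain u where u: "idet x u = 1" using iprim_complement assms by blast
  define h where "h = idet u y"
  have d: "d > 0" using assms by simp
  have cop: "coprime h d" using coprime_idet[OF u assms(2)] by (simp add: h_def d_def)
  define I where "I = {z. 0 < idet x z \<and> 0 < idet z y \<and> idet x z + idet z y < d}"
  define J where "J = {j. j \<in> {1..<d} \<and> j + h * j mod d < d}"
  have zy: "idet z y = idet z u * d + idet x z * h" for z
  proof -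
    have "idet z y * idet x u = idet z u * idet x y + idet x z * idet u y"
      unfolding idet_def by algebra
    then show ?thesis by (simp add: u h_def d_def)
  qed
  have mod: "h * idet x z mod d = idet z y" if "0 < idet z y" "idet z y < d" for z
  proof -
    have "idet z y mod d = h * idet x z mod d" unfolding zy by (simp add: mult.commute)
    then show ?thesis using that by simp
  qed
  have "bij_betw (idet x) I J"
  proof (rule bij_betw_imageI)
    show "inj_on (idet x) I"
    proof (rule inj_onI)
      fix z z' assume z: "z \<in> I" "z' \<in> I" "idet x z = idet x z'"
      then have "idet z y = idet z' y" using mod[of z] mod[of z'] by (simp add: I_def)
      then have "idet z u = idet z' u" using z d unfolding zy by simp
      then show "z = z'" using idet_basis[OF u, of z] idet_basis[OF u, of z'] z by metis
    qed
    show "idet x ` I = J"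
    proof safe
      fix z assume "z \<in> I"
      then show "idet x z \<in> J" using mod[of z] by (auto simp: I_def J_def)
    next
      fix j assume j: "j \<in> J"
      define k where "k = h * j div d"
      \<comment> \<open>The quotient \<open>k\<close> is the multiple of \<open>x\<close> that moves
        \<open>j\<close> times \<open>u\<close> into the parallelogram.\<close>
      define z where "z = (j * fst u - k * fst x, j * snd u - k * snd x)"
      have "idet x z = j * idet x u" by (simp add: z_def idet_def algebra_simps)
      then have xz: "idet x z = j" by (simp add: u)
      have "idet z y = h * j - k * d" by (simp add: z_def h_def d_def idet_def algebra_simps)
      then have "idet z y = h * j mod d" by (simp add: k_def minus_div_mult_eq_mod)
      then have "z \<in> I" using j xz mult_mod_pos[OF cop, of j] by (simp add: I_def J_def)
      then show "j \<in> idet x ` I" using xz by auto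
    qed
  qed
  then have "(\<Sum>j\<in>J. (1 - of_int (j + h * j mod d) / of_int d :: real)\<^sup>2)
      = (\<Sum>z\<in>I. (1 - of_int (idet x z + h * idet x z mod d) / of_int d)\<^sup>2)"
    by (rule sum.reindex_bij_betw[symmetric])
  also have "\<dots> = (\<Sum>z\<in>I. (1 - of_int (idet x z + idet z y) / of_int d)\<^sup>2)"
    using mod by (intro sum.cong refl) (auto simp: I_def)
  finally show ?thesis
    using triangle_sum_mod[OF cop d] assms(3) unfolding J_def I_def
    by (simp add: dpair_eq[OF u] h_def d_def)
qed

section \<open>Lattice bases, covolume and the dual basis\<close>

definition lat :: "real^2 \<Rightarrow> real^2 \<Rightarrow> int \<times> int \<Rightarrow> real^2" where
  "lat a b z = of_int (fst z) *\<^sub>R a + of_int (snd z) *\<^sub>R b"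

lemma lattice_basis_alt:
  "lattice_basis L u v \<longleftrightarrow> cross u v \<noteq> 0 \<and> L = range (lat u v)"
proof -
  have "{of_int a *\<^sub>R u + of_int b *\<^sub>R v | a b :: int. True} = range (lat u v)"
    by (auto simp: lat_def image_iff) (metis fst_conv snd_conv)
  moreover have "u \<noteq> v \<and> independent {u, v} \<longleftrightarrow> cross u v \<noteq> 0"
  proof
    assume a: "u \<noteq> v \<and> independent {u, v}"
    show "cross u v \<noteq> 0"
    proof
      assume c: "cross u v = 0"
      have "v \<noteq> 0" using a dependent_zero by auto
      have "(v \<bullet> v) *\<^sub>R u = (u \<bullet> v) *\<^sub>R v"
        using c by (simp add: vec_eq_2 inner_2 cross_def algebra_simps)
      then have "inverse (v \<bullet> v) *\<^sub>R ((v \<bullet> v) *\<^sub>R u) = inverse (v \<bullet> v) *\<^sub>R ((u \<bullet> v) *\<^sub>R v)" by simp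
      then have "u = ((u \<bullet> v) / (v \<bullet> v)) *\<^sub>R v"
        using \<open>v \<noteq> 0\<close> by (simp add: divide_inverse_commute)
      then have "u \<in> span {v}" by (metis span_base span_mul insertI1)
      then show False using a by (simp add: independent_insert)
    qed
  next
    assume c: "cross u v \<noteq> 0"
    then have ne: "u \<noteq> v" "v \<noteq> 0" by auto
    moreover have "u \<notin> span {v}"
    proof
      assume "u \<in> span {v}"
      then obtain k where "u = k *\<^sub>R v" by (auto simp: span_singleton)
      then show False using c by (simp add: cross_scale)
    qed
    ultimately show "u \<noteq> v \<and> independent {u, v}" by (simp add: independent_insert)
  qed
  ultimately show ?thesis unfolding lattice_basis_def by blast
qed

lemma cross_lat: "cross (lat a b x) (lat a b y) = cross a b * of_int (idet x y)"
  by (simp add: lat_def cross_add cross_scale idet_def cross_swap[of b a] algebra_simps)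

lemma lat_0 [simp]: "lat a b 0 = 0"
  by (simp add: lat_def)

lemma lat_inj:
  assumes "cross a b \<noteq> 0" "lat a b x = lat a b y"
  shows "x = y"
proof -
  have "cross (lat a b x) b = cross a b * of_int (fst x)" "cross a (lat a b x) = cross a b * of_int (snd x)" for x
    by (simp_all add: lat_def cross_add cross_scale)
  then show ?thesis using assms by (metis mult_cancel_left of_int_eq_iff prod_eqI)
qed

lemma measure_fundamental_parallelogram:
  "measure lebesgue (fundamental_parallelogram u v) = \<bar>cross u v\<bar>"
proof -
  define f where "f z = z $ 1 *\<^sub>R u + z $ 2 *\<^sub>R v" for z :: "real^2"
  have lin: "linear f" by (rule linearI) (simp_all add: f_def algebra_simps)
  have "fundamental_parallelogram u v = f ` cbox 0 1"
  proof
    show "fundamental_parallelogram u v \<subseteq> f ` cbox 0 1"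
    proof
      fix x assume "x \<in> fundamental_parallelogram u v"
      then obtain s t where st: "0 \<le> s" "s \<le> 1" "0 \<le> t" "t \<le> 1" "x = s *\<^sub>R u + t *\<^sub>R v"
        by (auto simp: fundamental_parallelogram_def)
      then have "x = f (vector [s, t])" "vector [s, t] \<in> cbox 0 (1 :: real^2)"
        by (auto simp: f_def mem_box_cart forall_2)
      then show "x \<in> f ` cbox 0 1" by blast
    qed
    show "f ` cbox 0 1 \<subseteq> fundamental_parallelogram u v"
      by (force simp: f_def fundamental_parallelogram_def mem_box_cart forall_2)
  qed
  then have "measure lebesgue (fundamental_parallelogram u v) = \<bar>det (matrix f)\<bar> * measure lebesgue (cbox 0 (1 :: real^2))"
    using measure_linear_image[OF lin, of "cbox 0 1"] by simp
  also have "measure lebesgue (cbox 0 (1 :: real^2)) = 1"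
    by (simp add: content_cbox_if_cart cbox_interval[symmetric] interval_eq_empty_cart measure_completion)
  also have "det (matrix f) = cross u v"
    by (simp add: det_2 matrix_def f_def cross_def axis_def)
  finally show ?thesis by simp
qed

text \<open>The determinants of the base changes in the two directions are integers with product 1,
  so all bases have the same absolute determinant.\<close>

lemma covolume_lat:
  assumes "cross a b > 0"
  shows "covolume (range (lat a b)) = cross a b"
  unfolding covolume_def measure_fundamental_parallelogram
proof (rule the_equality)
  have "lattice_basis (range (lat a b)) a b" using assms by (simp add: lattice_basis_alt)
  then show "\<exists>u v. lattice_basis (range (lat a b)) u v \<and> cross a b = \<bar>cross u v\<bar>" using assms by force
next
  fix c assume "\<exists>u v. lattice_basis (range (lat a b)) u v \<and> c = \<bar>cross u v\<bar>"
  then obtain u v where uv: "cross u v \<noteq> 0" "range (lat a b) = range (lat u v)" "c = \<bar>cross u v\<bar>"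
    by (auto simp: lattice_basis_alt)
  have self: "x \<in> range (lat x y)" "y \<in> range (lat x y)" for x y
    by (rule range_eqI[of _ _ "(1, 0)"], simp add: lat_def) (rule range_eqI[of _ _ "(0, 1)"], simp add: lat_def)
  have "u \<in> range (lat a b)" "v \<in> range (lat a b)" unfolding uv(2) by (rule self)+
  then obtain x y where "u = lat a b x" "v = lat a b y" by blast
  then have 1: "cross u v = cross a b * of_int (idet x y)" by (simp add: cross_lat)
  have "a \<in> range (lat u v)" "b \<in> range (lat u v)" unfolding uv(2)[symmetric] by (rule self)+
  then obtain x' y' where "a = lat u v x'" "b = lat u v y'" by blast
  then have "cross a b = cross u v * of_int (idet x' y')" by (simp add: cross_lat)
  then have "cross a b * 1 = cross a b * of_int (idet x y * idet x' y')" by (simp add: 1)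
  then have "idet x y * idet x' y' = 1" using assms unfolding mult_cancel_left by (metis less_irrefl of_int_eq_1_iff)
  then have "\<bar>idet x y\<bar> = 1" by (metis dvd_triv_left zdvd1_eq)
  then have "\<bar>real_of_int (idet x y)\<bar> = 1" by (metis of_int_1 of_int_abs)
  then show "c = cross a b" using assms by (simp add: uv(3) 1 abs_mult)
qed

text \<open>\<open>a'\<close> and \<open>b'\<close> form the dual basis, obtained from
  \<open>b\<close> and \<open>a\<close> by quarter turns.\<close>

lemma dual_lattice_lat:
  assumes "cross a b > 0"
  obtains a' b' where "dual_lattice (range (lat a b)) = range (lat a' b')" "cross a' b' = 1 / cross a b"
proof -
  define a' where "a' = (- 1 / cross a b) *\<^sub>R rot b"
  define b' where "b' = (1 / cross a b) *\<^sub>R rot a"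
  have in1: "a' \<bullet> a = 1" "a' \<bullet> b = 0" "b' \<bullet> a = 0" "b' \<bullet> b = 1"
    using assms by (simp_all add: a'_def b'_def rot_inner cross_swap[of b a])
  have cr: "cross a' b' = 1 / cross a b"
  proof -
    have "cross (rot b) (rot a) = - cross a b" by (simp add: cross_def)
    then show ?thesis using assms unfolding a'_def b'_def cross_scale by simp
  qed
  have dec: "y = (y \<bullet> a) *\<^sub>R a' + (y \<bullet> b) *\<^sub>R b'" for y
  proof -
    have "cross a' b' \<noteq> 0" using cr assms by simp
    from cross_basis[OF this, of y] obtain s t where y: "y = s *\<^sub>R a' + t *\<^sub>R b'" by blast
    then have "y \<bullet> a = s" "y \<bullet> b = t" by (simp_all add: inner_add_left in1)
    then show ?thesis using y by simp
  qed
  have mem: "y \<in> dual_lattice (range (lat a b)) \<longleftrightarrow> y \<bullet> a \<in> \<int> \<and> y \<bullet> b \<in> \<int>" for y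
  proof
    assume "y \<in> dual_lattice (range (lat a b))"
    then have "y \<bullet> lat a b z \<in> \<int>" for z unfolding dual_lattice_def by blast
    from this[of "(1, 0)"] this[of "(0, 1)"] show "y \<bullet> a \<in> \<int> \<and> y \<bullet> b \<in> \<int>" by (simp add: lat_def)
  next
    assume "y \<bullet> a \<in> \<int> \<and> y \<bullet> b \<in> \<int>"
    then show "y \<in> dual_lattice (range (lat a b))"
      by (auto simp: dual_lattice_def lat_def inner_add_right)
  qed
  have "dual_lattice (range (lat a b)) = range (lat a' b')"
  proof safe
    fix y assume "y \<in> dual_lattice (range (lat a b))"
    then obtain m n where "y \<bullet> a = of_int m" "y \<bullet> b = of_int n" unfolding mem by (auto elim!: Ints_cases)
    then have "y = lat a' b' (m, n)" using dec[of y] by (simp add: lat_def)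
    then show "y \<in> range (lat a' b')" by blast
  next
    fix z show "lat a' b' z \<in> dual_lattice (range (lat a b))"
      unfolding mem by (simp add: lat_def inner_add_left in1)
  qed
  then show ?thesis using that cr by blast
qed

text \<open>Supplies the vector \<open>e\<close> of the overview as the first vector of a positively
  oriented basis, so that its coordinates are \<open>(1, 0)\<close>.\<close>

lemma generic_basis:
  assumes "rank2_lattice N" "finite V" "V \<subseteq> N" "0 \<notin> V"
  obtains a b where "N = range (lat a b)" "cross a b > 0" "\<And>v. v \<in> V \<Longrightarrow> cross a v \<noteq> 0"
proof -
  obtain u w where uw: "cross u w \<noteq> 0" "N = range (lat u w)"
    using assms(1) unfolding rank2_lattice_def lattice_basis_alt by blast
  define c where "c v = (SOME z. v = lat u w z)" for v
  have c: "v = lat u w (c v)" if "v \<in> V" for v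
    unfolding c_def by (rule someI_ex) (use assms(3) that uw in blast)
  \<comment> \<open>\<open>u + K w\<close> is parallel to a vertex with coordinates
    \<open>(p, r)\<close> only if \<open>r = K * p\<close>; then \<open>p\<close> is nonzero and
    \<open>K\<close> is the quotient. So finitely many values have to be avoided.\<close>
  obtain K where K: "K \<notin> (\<lambda>v. snd (c v) div fst (c v)) ` V"
    using ex_new_if_finite[OF infinite_UNIV_int] assms(2) by blast
  define a where "a = u + of_int K *\<^sub>R w"
  define e :: int where "e = (if cross u w > 0 then 1 else - 1)"
  define b where "b = of_int e *\<^sub>R w"
  have cab: "cross a b > 0" using uw(1) by (auto simp: a_def b_def e_def cross_add cross_scale)
  have ee: "e * e = 1" by (simp add: e_def)
  have ee': "real_of_int e * (of_int e * x) = x" for x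
    using ee by (metis mult.assoc mult_1 of_int_1 of_int_mult)
  have "N = range (lat a b)"
  proof -
    have 1: "lat u w z = lat a b (fst z, e * (snd z - K * fst z))" for z
    proof -
      have "real_of_int (e * (snd z - K * fst z)) *\<^sub>R b = of_int (snd z - K * fst z) *\<^sub>R w"
        using ee'[of "of_int (snd z - K * fst z)"] by (simp add: b_def mult.commute mult.left_commute)
      then show ?thesis by (simp add: lat_def a_def algebra_simps)
    qed
    have 2: "lat a b z = lat u w (fst z, e * snd z + K * fst z)" for z
      by (simp add: lat_def a_def b_def algebra_simps)
    show ?thesis unfolding uw(2) using 1 2 by (metis (no_types, lifting) image_subsetI rangeI subset_antisym)
  qed
  moreover have "cross a v \<noteq> 0" if v: "v \<in> V" for v
  proof
    assume z: "cross a v = 0"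
    have "cross a v = cross u w * of_int (snd (c v) - K * fst (c v))"
      by (subst c[OF v]) (simp add: a_def lat_def cross_add cross_scale cross_swap[of w u] algebra_simps)
    then have q: "snd (c v) = K * fst (c v)" using z uw(1) by (simp del: of_int_diff of_int_mult)
    show False
    proof (cases "fst (c v) = 0")
      case True
      then have "c v = 0" using q by (simp add: prod_eq_iff)
      then show False using c[OF v] v assms(4) by simp
    next
      case False
      then have "K = snd (c v) div fst (c v)" using q by simp
      then show False using K v by blast
    qed
  qed
  ultimately show ?thesis using that cab by blast
qed

lemma primitive_point_lat:
  assumes "cross a b \<noteq> 0" "primitive_point (range (lat a b)) v"
  obtains z where "v = lat a b z" "iprim z"
proof -
  obtain z where z: "v = lat a b z" using assms by (auto simp: primitive_point_def)
  define g where "g = gcd (fst z) (snd z)"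
  have "v = of_int g *\<^sub>R lat a b (fst z div g, snd z div g)"
  proof -
    have "z = (g * (fst z div g), g * (snd z div g))" by (simp add: g_def)
    then have "v = lat a b (g * (fst z div g), g * (snd z div g))" using z by simp
    then show ?thesis by (simp add: lat_def scaleR_add_right)
  qed
  then have "\<bar>g\<bar> = 1" using assms(2) unfolding primitive_point_def by blast
  then have "iprim z" by (simp add: iprim_def g_def coprime_iff_gcd_eq_1)
  then show ?thesis using that z by blast
qed

text \<open>Both integer coordinates are quotients of a \<open>cross\<close> by the fixed
  determinant, hence bounded by Cauchy-Schwarz.\<close>

lemma finite_lat_bounded:
  assumes "cross a b \<noteq> 0" "bounded S"
  shows "finite {z. lat a b z \<in> S}"
proof -
  obtain B where B: "B > 0" "\<And>x. x \<in> S \<Longrightarrow> norm x \<le> B" using assms(2) unfolding bounded_pos by blast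
  define M where "M = \<lceil>B * (norm a + norm b) / \<bar>cross a b\<bar>\<rceil>"
  have cs: "\<bar>cross x y\<bar> \<le> norm x * norm y" for x y
  proof -
    have "norm (rot x) = norm x" by (simp add: norm_eq_sqrt_inner inner_2 add.commute)
    then show ?thesis using Cauchy_Schwarz_ineq2[of "rot x" y] by (simp add: rot_inner)
  qed
  have "{z. lat a b z \<in> S} \<subseteq> {-M..M} \<times> {-M..M}"
  proof
    fix z assume "z \<in> {z. lat a b z \<in> S}"
    then have n: "norm (lat a b z) \<le> B" using B by simp
    have est: "\<bar>k\<bar> \<le> M" if "\<bar>cross a b * of_int k\<bar> \<le> B * (norm a + norm b)" for k
    proof -
      have "\<bar>cross a b\<bar> * of_int \<bar>k\<bar> \<le> B * (norm a + norm b)" using that by (simp add: abs_mult)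
      then have "of_int \<bar>k\<bar> \<le> B * (norm a + norm b) / \<bar>cross a b\<bar>"
        using assms(1) by (simp add: field_simps)
      then show ?thesis unfolding M_def by linarith
    qed
    have "cross a b * of_int (fst z) = cross (lat a b z) b" "cross a b * of_int (snd z) = cross a (lat a b z)"
      by (simp_all add: lat_def cross_add cross_scale)
    moreover have "\<bar>cross (lat a b z) b\<bar> \<le> B * norm b"
      using cs[of "lat a b z" b] n by (meson mult_right_mono norm_ge_zero order_trans)
    moreover have "\<bar>cross a (lat a b z)\<bar> \<le> B * norm a"
      using cs[of a "lat a b z"] n by (metis mult.commute mult_right_mono norm_ge_zero order_trans)
    moreover have "B * norm a \<le> B * (norm a + norm b)" "B * norm b \<le> B * (norm a + norm b)"
      using B by auto
    ultimately have "\<bar>fst z\<bar> \<le> M" "\<bar>snd z\<bar> \<le> M" by (auto intro!: est)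
    then show "z \<in> {-M..M} \<times> {-M..M}" by (auto simp: mem_Times_iff)
  qed
  then show ?thesis by (rule finite_subset) auto
qed

section \<open>The lattice point sum of an LDP polygon\<close>

context polygon_cycle begin

text \<open>The sign condition says that \<open>x\<close> lies in the open cone over the edge of
  \<open>v\<close>, and these cones are disjoint. Used for \<open>b1\<close> and
  \<open>- b1\<close>, it counts the two sign changes.\<close>

lemma crossing_card:
  assumes "\<And>v. v \<in> V \<Longrightarrow> cross x v \<noteq> 0"
  shows "card {v \<in> V. cross x v < 0 \<and> cross x (\<sigma> v) > 0} = 1"
proof -
  obtain v where v: "v \<in> V" "\<And>v'. v' \<in> V \<Longrightarrow> ht v' x \<le> ht v x" using ht_max[of x] by blast
  obtain s t where st: "0 \<le> s" "0 \<le> t" "x = s *\<^sub>R v + t *\<^sub>R \<sigma> v" using cone_coords[OF v] by metis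
  have c: "cross x v = - t * cross v (\<sigma> v)" "cross x (\<sigma> v) = s * cross v (\<sigma> v)"
    by (simp_all add: st cross_add cross_scale cross_swap[of v "\<sigma> v"])
  then have "s \<noteq> 0" "t \<noteq> 0" using assms[OF v(1)] assms[OF \<sigma>_in[OF v(1)]] by auto
  then have p: "s > 0" "t > 0" using st by auto
  have "{v \<in> V. cross x v < 0 \<and> cross x (\<sigma> v) > 0} = {v}"
  proof (intro equalityI subsetI)
    fix w assume "w \<in> {v}"
    then show "w \<in> {v \<in> V. cross x v < 0 \<and> cross x (\<sigma> v) > 0}"
      using v(1) p pos[OF v(1)] by (simp add: c)
  next
    fix w assume "w \<in> {v \<in> V. cross x v < 0 \<and> cross x (\<sigma> v) > 0}"
    then have w: "w \<in> V" "cross w x > 0" "cross x (\<sigma> w) > 0" using cross_swap[of x w] by auto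
    have "x = (cross x (\<sigma> w) / cross w (\<sigma> w)) *\<^sub>R w + (cross w x / cross w (\<sigma> w)) *\<^sub>R \<sigma> w"
      using cross_basis pos[OF w(1)] by force
    moreover have "cross x (\<sigma> w) / cross w (\<sigma> w) > 0" "cross w x / cross w (\<sigma> w) > 0"
      using w pos[OF w(1)] by auto
    ultimately have "w = v" using cone_interior_unique[OF w(1) _ _ v(1) p] st(3) by metis
    then show "w \<in> {v}" by simp
  qed
  then show ?thesis by simp
qed

lemma sum_\<sigma>: "(\<Sum>v\<in>V. f (\<sigma> v)) = (\<Sum>v\<in>V. f v)"
  by (rule sum.reindex_bij_betw[OF bij])

end

text \<open>\<open>co\<close> gives integer coordinates in the basis \<open>b1\<close>,
  \<open>b2\<close>, and \<open>b1\<close> plays the role of \<open>e\<close>.\<close>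

locale ldp_cycle = polygon_cycle +
  fixes b1 b2 :: "real^2" and co :: "real^2 \<Rightarrow> int \<times> int"
  assumes D_pos: "cross b1 b2 > 0"
    and co: "v \<in> V \<Longrightarrow> lat b1 b2 (co v) = v"
    and prim: "v \<in> V \<Longrightarrow> iprim (co v)"
    and generic: "v \<in> V \<Longrightarrow> cross b1 v \<noteq> 0"
begin

definition d :: "real^2 \<Rightarrow> int" where "d v = idet (co v) (co (\<sigma> v))"

text \<open>The determinant of \<open>(1, 0)\<close>, the coordinates of \<open>b1\<close>, with
  \<open>co v\<close>.\<close>

definition q :: "real^2 \<Rightarrow> int" where "q v = snd (co v)"

lemma cross_co: "\<lbrakk>u \<in> V; v \<in> V\<rbrakk> \<Longrightarrow> cross u v = cross b1 b2 * of_int (idet (co u) (co v))"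
  using cross_lat[of b1 b2 "co u" "co v"] co by simp

lemma d_pos: "v \<in> V \<Longrightarrow> d v > 0"
  using cross_co[of v "\<sigma> v"] \<sigma>_in[of v] pos[of v] D_pos by (simp add: d_def zero_less_mult_iff)

lemma cross_b1: "v \<in> V \<Longrightarrow> cross b1 v = cross b1 b2 * of_int (q v)"
  using cross_lat[of b1 b2 "(1, 0)" "co v"] co by (simp add: idet_def q_def lat_def)

lemma q_neq_0: "v \<in> V \<Longrightarrow> q v \<noteq> 0"
  using generic cross_b1 by auto

text \<open>Exactly two edges contribute \<open>-1\<close> instead of 1, one crossing the ray of
  \<open>b1\<close> and one the opposite ray; each lowers the sum by 2.\<close>

lemma sum_sgn: "(\<Sum>v\<in>V. sgn (q v * q (\<sigma> v))) = int (card V) - 4"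
proof -
  define A where "A = {v \<in> V. cross b1 v < 0 \<and> cross b1 (\<sigma> v) > 0}"
  define B where "B = {v \<in> V. cross (- b1) v < 0 \<and> cross (- b1) (\<sigma> v) > 0}"
  have m: "cross (- b1) v = - cross b1 v" for v using cross_scale(1)[of "-1" b1 v] by simp
  have "card A = 1" unfolding A_def by (rule crossing_card) (rule generic)
  moreover have "card B = 1" unfolding B_def by (rule crossing_card) (simp add: m generic)
  moreover have A: "A = {v \<in> V. q v < 0 \<and> q (\<sigma> v) > 0}" and B: "B = {v \<in> V. q v > 0 \<and> q (\<sigma> v) < 0}"
    unfolding A_def B_def using cross_b1 D_pos \<sigma>_in
    by (auto simp: m mult_less_0_iff zero_less_mult_iff)
  have "A \<inter> B = {}" unfolding A B by auto
  ultimately have AB: "card (A \<union> B) = 2" using card_Un_disjoint[of A B] finV by (simp add: A B)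
  have "(\<Sum>v\<in>V. sgn (q v * q (\<sigma> v))) = (\<Sum>v\<in>V. 1 - 2 * (if v \<in> A \<union> B then 1 else 0))"
  proof (intro sum.cong refl)
    fix v assume v: "v \<in> V"
    have "q v \<noteq> 0" "q (\<sigma> v) \<noteq> 0" using q_neq_0 v \<sigma>_in by auto
    then show "sgn (q v * q (\<sigma> v)) = 1 - 2 * (if v \<in> A \<union> B then 1 else 0)"
      using v unfolding A B by (auto simp: sgn_mult sgn_if mult_less_0_iff zero_less_mult_iff)
  qed
  also have "\<dots> = int (card V) - 2 * int (card (V \<inter> (A \<union> B)))"
    using finV by (simp add: sum_subtractf sum_distrib_left[symmetric] sum.If_cases Un_def)
  also have "V \<inter> (A \<union> B) = A \<union> B" unfolding A B by auto
  finally show ?thesis using AB by simp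
qed

text \<open>\<open>E\<close> is the part of the three-term law that does not telescope; it reappears in the dual volume.\<close>

definition E :: real where
  "E = (\<Sum>v\<in>V. of_int ((q v)\<^sup>2 + (q (\<sigma> v))\<^sup>2) / of_int (d v * q v * q (\<sigma> v)))"

lemma sum_dpair: "12 * (\<Sum>v\<in>V. dpair (co v) (co (\<sigma> v))) = 3 * of_nat (card V) - 12 - E"
proof -
  define e where "e = (1 :: int, 0 :: int)"
  have e: "iprim e" by (simp add: iprim_def e_def)
  define p where "p v = real_of_int (fst (co v))" for v
  \<comment> \<open>All that telescopes: the Dedekind sum with \<open>e\<close> and the slope
    \<open>p / q\<close>, which arises from \<open>d = p * q' - p' * q\<close> divided by
    \<open>q * q'\<close>.\<close>
  define g where "g v = 12 * dpair e (co v) + p v / of_int (q v)" for v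
  have edge: "12 * dpair (co v) (co (\<sigma> v)) = 
      3 * of_int (sgn (q v * q (\<sigma> v))) + g (\<sigma> v) - g v
      - of_int ((q v)\<^sup>2 + (q (\<sigma> v))\<^sup>2) / of_int (d v * q v * q (\<sigma> v))"
    (is "_ = ?R") if v: "v \<in> V" for v
  proof -
    note w = \<sigma>_in[OF v]
    have det: "idet (co (\<sigma> v)) e = - q (\<sigma> v)" "idet e (co v) = q v"
      by (simp_all add: idet_def e_def q_def)
    have "three_term (co v) (co (\<sigma> v)) e"
      using prim v w e d_pos[OF v] q_neq_0 det by (intro three_term_law) (auto simp: d_def)
    then have 1: "12 * (dpair (co v) (co (\<sigma> v)) + dpair (co (\<sigma> v)) e + dpair e (co v)) =
      - (of_int ((d v)\<^sup>2 + (q (\<sigma> v))\<^sup>2 + (q v)\<^sup>2) / of_int (d v * q (\<sigma> v) * q v)) + 3 * of_int (sgn (q v * q (\<sigma> v)))"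
      unfolding three_term_def det d_def[symmetric] using d_pos[OF v] by (simp add: sgn_mult sgn_minus mult_ac)
    have 2: "dpair (co (\<sigma> v)) e = - dpair e (co (\<sigma> v))" using dpair_swap e prim w by blast
    have dd: "real_of_int (d v) = p v * of_int (q (\<sigma> v)) - p (\<sigma> v) * of_int (q v)"
      by (simp add: d_def idet_def p_def q_def mult.commute)
    have nz: "real_of_int (q v) \<noteq> 0" "real_of_int (q (\<sigma> v)) \<noteq> 0" "real_of_int (d v) \<noteq> 0"
      using q_neq_0 v w d_pos[OF v] by auto
    have "of_int ((d v)\<^sup>2 + (q (\<sigma> v))\<^sup>2 + (q v)\<^sup>2) / of_int (d v * q (\<sigma> v) * q v)
      = of_int ((q v)\<^sup>2 + (q (\<sigma> v))\<^sup>2) / of_int (d v * q v * q (\<sigma> v)) + real_of_int (d v) / of_int (q v * q (\<sigma> v))"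
      using nz by (simp add: field_simps power2_eq_square)
    also have "real_of_int (d v) / of_int (q v * q (\<sigma> v)) = p v / of_int (q v) - p (\<sigma> v) / of_int (q (\<sigma> v))"
      unfolding dd using nz(1,2) by (simp add: field_simps)
    finally show ?thesis using 1 2 by (simp add: g_def)
  qed
  have "12 * (\<Sum>v\<in>V. dpair (co v) (co (\<sigma> v))) = (\<Sum>v\<in>V. 3 * of_int (sgn (q v * q (\<sigma> v))) + g (\<sigma> v) - g v
      - of_int ((q v)\<^sup>2 + (q (\<sigma> v))\<^sup>2) / of_int (d v * q v * q (\<sigma> v)))"
    unfolding sum_distrib_left by (intro sum.cong refl edge)
  also have "\<dots> = 3 * of_int (\<Sum>v\<in>V. sgn (q v * q (\<sigma> v))) - E"
    unfolding sum.distrib sum_subtractf sum_\<sigma> E_def sum_distrib_left of_int_sum by simp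
  finally show ?thesis unfolding sum_sgn by simp
qed

abbreviation N where "N \<equiv> range (lat b1 b2)"

abbreviation \<Delta> where "\<Delta> \<equiv> convex hull V"

section \<open>The two volumes in terms of edge determinants\<close>

lemma volume: "normalized_volume N \<Delta> = (\<Sum>v\<in>V. of_int (d v))"
proof -
  have "(\<Sum>v\<in>V. cross v (\<sigma> v)) = cross b1 b2 * (\<Sum>v\<in>V. of_int (d v))"
    unfolding sum_distrib_left by (intro sum.cong refl) (simp add: cross_co \<sigma>_in d_def)
  then show ?thesis using D_pos by (simp add: normalized_volume_def covolume_lat area_hull)
qed

lemma dual_volume: "normalized_volume (dual_lattice N) (dual_polygon \<Delta>) = (\<Sum>v\<in>V. 2 / of_int (d v)) - E"
proof -
  obtain c1 c2 where c: "dual_lattice N = range (lat c1 c2)" "cross c1 c2 = 1 / cross b1 b2"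
    using dual_lattice_lat[OF D_pos] .
  have cov: "covolume (dual_lattice N) = 1 / cross b1 b2"
    unfolding c(1) using c(2) D_pos by (subst covolume_lat) auto
  \<comment> \<open>Each dual triangle involves two consecutive edges. \<open>g v\<close> is the
    share of the edge of \<open>v\<close> and \<open>f (\<sigma> v)\<close> that of the next edge;
    reindexing \<open>f\<close> unites the two shares of each edge.\<close>
  define f where "f v = 1 / real_of_int (d v) - of_int (q (\<sigma> v)) / of_int (q v * d v)" for v
  define g where "g v = 1 / real_of_int (d v) - of_int (q v) / of_int (q (\<sigma> v) * d v)" for v
  have "cross b1 b2 * cross (dv v) (dv (\<sigma> v)) = g v + f (\<sigma> v)" if v: "v \<in> V" for v
  proof -
    note w = \<sigma>_in[OF v]
    note z = \<sigma>_in[OF w]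
    define k where "k = idet (co v) (co (\<sigma> (\<sigma> v)))"
    have cr: "cross v (\<sigma> v) = cross b1 b2 * of_int (d v)" "cross (\<sigma> v) (\<sigma> (\<sigma> v)) = cross b1 b2 * of_int (d (\<sigma> v))"
      "cross v (\<sigma> (\<sigma> v)) = cross b1 b2 * of_int k"
      using v w z by (simp_all add: cross_co d_def k_def)
    \<comment> \<open>A Pluecker relation with \<open>e\<close>; it eliminates the determinant
      \<open>k\<close> of vertices two steps apart, the only term that couples the two
      edges.\<close>
    have "k * q (\<sigma> v) = q v * d (\<sigma> v) + q (\<sigma> (\<sigma> v)) * d v"
      unfolding k_def d_def q_def idet_def by algebra
    then have k: "real_of_int k * of_int (q (\<sigma> v)) = of_int (q v) * of_int (d (\<sigma> v)) + of_int (q (\<sigma> (\<sigma> v))) * of_int (d v)"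
      by (metis of_int_add of_int_mult)
    have nz: "real_of_int (q (\<sigma> v)) \<noteq> 0" "real_of_int (d v) \<noteq> 0" "real_of_int (d (\<sigma> v)) \<noteq> 0"
      using q_neq_0 v w d_pos[OF v] d_pos[OF w] by auto
    have "cross b1 b2 * cross (dv v) (dv (\<sigma> v)) =
        (of_int (d v) + of_int (d (\<sigma> v)) - of_int k) / (of_int (d v) * of_int (d (\<sigma> v)))"
      unfolding cross_dv[OF v] cr using D_pos nz by (simp add: field_simps)
    also have "\<dots> = g v + f (\<sigma> v)"
    proof -
      have e: "real_of_int k = (of_int (q v) * of_int (d (\<sigma> v)) + of_int (q (\<sigma> (\<sigma> v))) * of_int (d v)) / of_int (q (\<sigma> v))"
        using k nz by (simp add: field_simps)
      show ?thesis unfolding e g_def f_def using nz by (simp add: field_simps)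
    qed
    finally show ?thesis .
  qed
  then have "cross b1 b2 * (\<Sum>v\<in>V. cross (dv v) (dv (\<sigma> v))) = (\<Sum>v\<in>V. g v + f (\<sigma> v))"
    unfolding sum_distrib_left by (intro sum.cong refl) simp
  also have "\<dots> = (\<Sum>v\<in>V. g v + f v)"
    unfolding sum.distrib sum_\<sigma>[of f] ..
  also have "\<dots> = (\<Sum>v\<in>V. 2 / of_int (d v) - of_int ((q v)\<^sup>2 + (q (\<sigma> v))\<^sup>2) / of_int (d v * q v * q (\<sigma> v)))"
  proof (intro sum.cong refl)
    fix v assume v: "v \<in> V"
    have nz: "real_of_int (q v) \<noteq> 0" "real_of_int (q (\<sigma> v)) \<noteq> 0" "real_of_int (d v) \<noteq> 0"
      using q_neq_0 v \<sigma>_in[OF v] d_pos[OF v] by auto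
    then show "g v + f v = 2 / of_int (d v) - of_int ((q v)\<^sup>2 + (q (\<sigma> v))\<^sup>2) / of_int (d v * q v * q (\<sigma> v))"
      by (simp add: g_def f_def field_simps power2_eq_square)
  qed
  finally show ?thesis
    unfolding normalized_volume_def cov area_dual E_def sum_subtractf[symmetric] using D_pos
    by (simp add: mult.commute)
qed

lemma ht_lat:
  assumes "v \<in> V"
  shows "ht v (lat b1 b2 z) = of_int (idet (co v) z + idet z (co (\<sigma> v))) / of_int (d v)"
proof -
  have "cross v (lat b1 b2 z) = cross b1 b2 * of_int (idet (co v) z)"
    "cross (lat b1 b2 z) (\<sigma> v) = cross b1 b2 * of_int (idet z (co (\<sigma> v)))"
    "cross v (\<sigma> v) = cross b1 b2 * of_int (d v)"
    using cross_lat[of b1 b2 "co v" z] cross_lat[of b1 b2 z "co (\<sigma> v)"] cross_lat[of b1 b2 "co v" "co (\<sigma> v)"]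
      co assms \<sigma>_in by (simp_all add: d_def)
  then show ?thesis using D_pos by (simp add: ht_def flip: distrib_left)
qed

section \<open>The lattice points that contribute to the sum\<close>

lemma finite_lattice_points: "finite (\<Delta> \<inter> N)"
proof -
  have "bounded \<Delta>" using finV by (simp add: finite_imp_bounded_convex_hull)
  then have "finite {z. lat b1 b2 z \<in> \<Delta>}" using finite_lat_bounded D_pos by (metis less_irrefl)
  then have "finite (lat b1 b2 ` {z. lat b1 b2 z \<in> \<Delta>})" by blast
  moreover have "\<Delta> \<inter> N \<subseteq> lat b1 b2 ` {z. lat b1 b2 z \<in> \<Delta>}" by auto
  ultimately show ?thesis by (rule rev_finite_subset)
qed

definition I :: "real^2 \<Rightarrow> (real^2) set" where
  "I v = {x \<in> N. cross v x > 0 \<and> cross x (\<sigma> v) > 0 \<and> ht v x < 1}"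

lemma I_coords:
  assumes "v \<in> V" "x \<in> I v"
  obtains s t where "0 < s" "0 < t" "s + t < 1" "x = s *\<^sub>R v + t *\<^sub>R \<sigma> v" "ht v x = s + t"
proof -
  define s t where "s = cross x (\<sigma> v) / cross v (\<sigma> v)" "t = cross v x / cross v (\<sigma> v)"
  note st = this
  have "0 < s" "0 < t" using assms pos[OF assms(1)] by (simp_all add: st I_def)
  moreover have "x = s *\<^sub>R v + t *\<^sub>R \<sigma> v" using cross_basis[of v "\<sigma> v" x] pos[OF assms(1)] by (simp add: st)
  moreover from this have "ht v x = s + t" using assms(1) by (simp add: ht_linear)
  ultimately show ?thesis using that assms(2) by (simp add: I_def)
qed

lemma sum_I:
  assumes "v \<in> V"
  shows "(\<Sum>x\<in>I v. (1 - ht v x)\<^sup>2) = (of_int (d v) - 1) * (of_int (d v) - 2) / (12 * of_int (d v)) + dpair (co v) (co (\<sigma> v))"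
proof -
  define Z where "Z = {z. 0 < idet (co v) z \<and> 0 < idet z (co (\<sigma> v)) \<and> idet (co v) z + idet z (co (\<sigma> v)) < d v}"
  have inj: "inj_on (lat b1 b2) Z" using lat_inj[of b1 b2] D_pos by (intro inj_onI) (auto simp: less_imp_neq)
  have "lat b1 b2 z \<in> I v \<longleftrightarrow> z \<in> Z" for z
  proof -
    have "cross v (lat b1 b2 z) = cross b1 b2 * of_int (idet (co v) z)"
      "cross (lat b1 b2 z) (\<sigma> v) = cross b1 b2 * of_int (idet z (co (\<sigma> v)))"
      using cross_lat[of b1 b2 "co v" z] cross_lat[of b1 b2 z "co (\<sigma> v)"] co assms \<sigma>_in by simp_all
    then show ?thesis using D_pos d_pos[OF assms]
      unfolding I_def Z_def mem_Collect_eq ht_lat[OF assms]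
      by (simp add: zero_less_mult_iff) linarith
  qed
  then have I: "I v = lat b1 b2 ` Z" by (auto simp: I_def)
  have "(\<Sum>x\<in>I v. (1 - ht v x)\<^sup>2) = (\<Sum>z\<in>Z. (1 - of_int (idet (co v) z + idet z (co (\<sigma> v))) / of_int (d v))\<^sup>2)"
    unfolding I sum.reindex[OF inj] by (simp add: ht_lat[OF assms])
  then show ?thesis
    using triangle_sum[of "co v" "co (\<sigma> v)"] prim assms \<sigma>_in d_pos[OF assms] unfolding Z_def d_def by auto
qed

lemma I_max:
  assumes "v \<in> V" "x \<in> I v" "v' \<in> V"
  shows "ht v' x \<le> ht v x"
proof -
  obtain s t where "0 < s" "0 < t" "x = s *\<^sub>R v + t *\<^sub>R \<sigma> v" "ht v x = s + t" using I_coords[OF assms(1,2)] by metis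
  then show ?thesis using cone_max[OF assms(1) _ _ assms(3), of s t] by simp
qed

text \<open>The determinant with a complement of \<open>co v\<close> shows that \<open>s\<close> is
  an integer.\<close>

lemma primitive_multiple:
  assumes "v \<in> V" "s *\<^sub>R v \<in> N" "0 < s"
  shows "s \<ge> 1"
proof -
  obtain u where u: "idet (co v) u = 1" using iprim_complement prim assms(1) by blast
  obtain z where z: "s *\<^sub>R v = lat b1 b2 z" using assms by blast
  have "cross b1 b2 * of_int (idet z u) = cross (s *\<^sub>R v) (lat b1 b2 u)" unfolding z cross_lat ..
  also have "\<dots> = s * cross b1 b2"
    using cross_lat[of b1 b2 "co v" u] co[OF assms(1)] by (simp add: cross_scale u)
  finally have "s = of_int (idet z u)" using D_pos by simp
  then show ?thesis using assms(3) by simp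
qed

lemma kappa_0: "kappa \<Delta> 0 = 0"
proof -
  obtain v where "v \<in> V" using V_nonempty by blast
  then show ?thesis using kappa_eq[of v 0] by simp
qed

text \<open>A nonzero lattice point of height below 1 cannot lie on the ray of a vertex, because the
  vertex is primitive. So it is in exactly one \<open>I v\<close>, and all remaining nonzero points
  have \<open>kappa = -1\<close>.\<close>

lemma lattice_sum: "(\<Sum>n\<in>\<Delta> \<inter> N. (kappa \<Delta> n + 1)\<^sup>2) = 1 + (\<Sum>v\<in>V. \<Sum>x\<in>I v. (1 - ht v x)\<^sup>2)"
proof -
  have 0: "0 \<in> \<Delta> \<inter> N" using zero lat_0 by (metis IntI rangeI)
  have IP: "I v \<subseteq> \<Delta> \<inter> N" if "v \<in> V" for v
    using I_max[OF that] by (force simp: I_def hull_eq)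
  then have fin: "finite (I v)" if "v \<in> V" for v using finite_lattice_points finite_subset that by blast
  have 0: "0 \<notin> I v" for v by (simp add: I_def)
  have "(\<Sum>n\<in>\<Delta> \<inter> N. (kappa \<Delta> n + 1)\<^sup>2) = (\<Sum>n\<in>insert 0 (\<Union>v\<in>V. I v). (kappa \<Delta> n + 1)\<^sup>2)"
  proof (rule sum.mono_neutral_right[OF finite_lattice_points])
    show "insert 0 (\<Union>v\<in>V. I v) \<subseteq> \<Delta> \<inter> N" using IP \<open>0 \<in> \<Delta> \<inter> N\<close> by auto
    show "\<forall>n\<in>\<Delta> \<inter> N - insert 0 (\<Union>v\<in>V. I v). (kappa \<Delta> n + 1)\<^sup>2 = 0"
    proof
      fix n assume n: "n \<in> \<Delta> \<inter> N - insert 0 (\<Union>v\<in>V. I v)"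
      obtain v where v: "v \<in> V" "\<And>v'. v' \<in> V \<Longrightarrow> ht v' n \<le> ht v n" using ht_max[of n] by blast
      obtain s t where st: "0 \<le> s" "0 \<le> t" "n = s *\<^sub>R v + t *\<^sub>R \<sigma> v" "ht v n = s + t"
        using cone_coords[OF v] by metis
      have le: "s + t \<le> 1" using n v(1) st(4) by (auto simp: hull_eq)
      have "s + t \<ge> 1"
      proof (rule ccontr)
        assume lt: "\<not> s + t \<ge> 1"
        have "cross v n = t * cross v (\<sigma> v)" "cross n (\<sigma> v) = s * cross v (\<sigma> v)"
          by (simp_all add: st(3) cross_add cross_scale)
        then have "s = 0 \<or> t = 0"
          using n v(1) st lt pos[OF v(1)] unfolding I_def by (force simp: zero_less_mult_iff)
        then consider "s = 0" "t = 0" | "s > 0" "t = 0" | "s = 0" "t > 0" using st by linarith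
        then show False
        proof cases
          case 1
          then show False using n st by simp
        next
          case 2
          then show False using primitive_multiple[OF v(1), of s] n st(3) lt by auto
        next
          case 3
          then show False using primitive_multiple[OF \<sigma>_in[OF v(1)], of t] n st(3) lt by auto
        qed
      qed
      then show "(kappa \<Delta> n + 1)\<^sup>2 = 0" using kappa_eq[OF v] st(4) le by simp
    qed
  qed
  also have "\<dots> = 1 + (\<Sum>n\<in>(\<Union>v\<in>V. I v). (kappa \<Delta> n + 1)\<^sup>2)"
    using 0 finV fin by (subst sum.insert) (auto simp: kappa_0)
  also have "(\<Sum>n\<in>(\<Union>v\<in>V. I v). (kappa \<Delta> n + 1)\<^sup>2) = (\<Sum>v\<in>V. \<Sum>n\<in>I v. (kappa \<Delta> n + 1)\<^sup>2)"
  proof (rule sum.UNION_disjoint[OF finV])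
    show "\<forall>v\<in>V. finite (I v)" using fin by blast
    show "\<forall>v\<in>V. \<forall>v'\<in>V. v \<noteq> v' \<longrightarrow> I v \<inter> I v' = {}"
    proof (intro ballI impI)
      fix v v' assume v: "v \<in> V" "v' \<in> V" "v \<noteq> v'"
      show "I v \<inter> I v' = {}"
      proof (rule equals0I)
        fix x assume x: "x \<in> I v \<inter> I v'"
        obtain s t where 1: "0 < s" "0 < t" "x = s *\<^sub>R v + t *\<^sub>R \<sigma> v" using I_coords[OF v(1), of x] x by blast
        obtain s' t' where 2: "0 < s'" "0 < t'" "x = s' *\<^sub>R v' + t' *\<^sub>R \<sigma> v'" using I_coords[OF v(2), of x] x by blast
        show False using cone_interior_unique[OF v(1) 1(1,2) v(2) 2(1,2)] 1(3) 2(3) v(3) by simp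
      qed
    qed
  qed
  also have "\<dots> = (\<Sum>v\<in>V. \<Sum>x\<in>I v. (1 - ht v x)\<^sup>2)"
  proof (intro sum.cong refl)
    fix v x assume "v \<in> V" "x \<in> I v"
    then show "(kappa \<Delta> x + 1)\<^sup>2 = (1 - ht v x)\<^sup>2" using kappa_eq[OF _ I_max, of v x] by simp
  qed
  finally show ?thesis .
qed

lemma main_identity:
  "12 * (\<Sum>n\<in>\<Delta> \<inter> N. (kappa \<Delta> n + 1)\<^sup>2) = normalized_volume N \<Delta> + normalized_volume (dual_lattice N) (dual_polygon \<Delta>)"
proof -
  have "12 * (\<Sum>n\<in>\<Delta> \<inter> N. (kappa \<Delta> n + 1)\<^sup>2) = 12 + (\<Sum>v\<in>V. 12 * (\<Sum>x\<in>I v. (1 - ht v x)\<^sup>2))"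
    by (simp add: lattice_sum sum_distrib_left)
  also have "(\<Sum>v\<in>V. 12 * (\<Sum>x\<in>I v. (1 - ht v x)\<^sup>2)) = (\<Sum>v\<in>V. of_int (d v) - 3 + 2 / of_int (d v) + 12 * dpair (co v) (co (\<sigma> v)))"
  proof (intro sum.cong refl)
    fix v assume v: "v \<in> V"
    have "real_of_int (d v) \<noteq> 0" using d_pos[OF v] by simp
    then have "12 * ((of_int (d v) - 1) * (of_int (d v) - 2) / (12 * of_int (d v))) = of_int (d v) - 3 + 2 / real_of_int (d v)"
      by (simp add: field_simps)
    then show "12 * (\<Sum>x\<in>I v. (1 - ht v x)\<^sup>2) = of_int (d v) - 3 + 2 / of_int (d v) + 12 * dpair (co v) (co (\<sigma> v))"
      unfolding sum_I[OF v] by simp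
  qed
  also have "\<dots> = (\<Sum>v\<in>V. of_int (d v)) - 3 * of_nat (card V) + (\<Sum>v\<in>V. 2 / of_int (d v)) + 12 * (\<Sum>v\<in>V. dpair (co v) (co (\<sigma> v)))"
    by (simp add: sum.distrib sum_subtractf sum_distrib_left)
  \<comment> \<open>In \<open>sum_dpair\<close> the \<open>3 * card V\<close> cancels the
    \<open>-3\<close> of every edge, the \<open>-12\<close> cancels the origin, and \<open>E\<close>
    is the one in \<open>dual_volume\<close>.\<close>
  finally show ?thesis unfolding volume dual_volume sum_dpair by simp
qed

section \<open>The equality case\<close>

lemma sum_ge_1: "(\<Sum>n\<in>\<Delta> \<inter> N. (kappa \<Delta> n + 1)\<^sup>2) \<ge> 1"
  and sum_eq_1_iff: "(\<Sum>n\<in>\<Delta> \<inter> N. (kappa \<Delta> n + 1)\<^sup>2) = 1 \<longleftrightarrow> (\<forall>n\<in>\<Delta> \<inter> N. n \<noteq> 0 \<longrightarrow> kappa \<Delta> n = -1)"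
proof -
  have "0 \<in> \<Delta> \<inter> N" using zero lat_0 by (metis IntI rangeI)
  then have e: "(\<Sum>n\<in>\<Delta> \<inter> N. (kappa \<Delta> n + 1)\<^sup>2) = 1 + (\<Sum>n\<in>\<Delta> \<inter> N - {0}. (kappa \<Delta> n + 1)\<^sup>2)"
    using sum.remove[OF finite_lattice_points, of 0 "\<lambda>n. (kappa \<Delta> n + 1)\<^sup>2"] kappa_0 by (simp del: Int_iff)
  then show "(\<Sum>n\<in>\<Delta> \<inter> N. (kappa \<Delta> n + 1)\<^sup>2) \<ge> 1" by (simp add: sum_nonneg)
  have "(\<Sum>n\<in>\<Delta> \<inter> N - {0}. (kappa \<Delta> n + 1)\<^sup>2) = 0 \<longleftrightarrow> (\<forall>n\<in>\<Delta> \<inter> N - {0}. (kappa \<Delta> n + 1)\<^sup>2 = 0)"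
    using finite_lattice_points by (intro sum_nonneg_eq_0_iff) auto
  then show "(\<Sum>n\<in>\<Delta> \<inter> N. (kappa \<Delta> n + 1)\<^sup>2) = 1 \<longleftrightarrow> (\<forall>n\<in>\<Delta> \<inter> N. n \<noteq> 0 \<longrightarrow> kappa \<Delta> n = -1)"
    unfolding e by (simp add: add_eq_0_iff2) blast
qed

text \<open>A suitable complement \<open>n\<close> of \<open>v\<close> lies in the triangle over the
  edge, so by assumption it has height 1. Then \<open>ht v\<close> is 1 on the lattice basis
  \<open>v\<close>, \<open>n\<close> and therefore integral on the lattice.\<close>

lemma dual_vertex_integral:
  assumes "\<forall>n\<in>\<Delta> \<inter> N. n \<noteq> 0 \<longrightarrow> kappa \<Delta> n = -1" "v \<in> V"
  shows "dv v \<in> dual_lattice N"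
proof -
  obtain u' where u': "idet (co v) u' = 1" using iprim_complement prim assms(2) by blast
  \<comment> \<open>Subtracting \<open>k\<close> times \<open>v\<close> brings the second
    determinant \<open>h\<close> into the range from 0 to \<open>d v - 1\<close>; the height
    \<open>(1 + h) / d v\<close> is then at most 1.\<close>
  define k where "k = idet u' (co (\<sigma> v)) div d v"
  define u where "u = (fst u' - k * fst (co v), snd u' - k * snd (co v))"
  have u: "idet (co v) u = 1" using u' by (simp add: u_def idet_def algebra_simps)
  have "idet u (co (\<sigma> v)) = idet u' (co (\<sigma> v)) - k * d v" by (simp add: u_def d_def idet_def algebra_simps)
  then have "idet u (co (\<sigma> v)) = idet u' (co (\<sigma> v)) mod d v" by (simp add: k_def minus_div_mult_eq_mod)
  then have h: "0 \<le> idet u (co (\<sigma> v))" "idet u (co (\<sigma> v)) < d v" using d_pos[OF assms(2)] by simp_all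
  define n where "n = lat b1 b2 u"
  have cr: "cross v n = cross b1 b2" "cross n (\<sigma> v) = cross b1 b2 * of_int (idet u (co (\<sigma> v)))"
    using cross_lat[of b1 b2 "co v" u] cross_lat[of b1 b2 u "co (\<sigma> v)"] co assms(2) \<sigma>_in u by (simp_all add: n_def)
  have n0: "n \<noteq> 0" using cr(1) D_pos by auto
  have hn: "ht v n = of_int (1 + idet u (co (\<sigma> v))) / of_int (d v)" using ht_lat[OF assms(2)] u by (simp add: n_def)
  have le1: "ht v n \<le> 1" unfolding hn using h d_pos[OF assms(2)] by simp
  define s t where "s = cross n (\<sigma> v) / cross v (\<sigma> v)" "t = cross v n / cross v (\<sigma> v)"
  note st = this
  have st0: "0 \<le> s" "0 \<le> t" using pos[OF assms(2)] D_pos h(1) by (simp_all add: st cr)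
  have nst: "n = s *\<^sub>R v + t *\<^sub>R \<sigma> v" using cross_basis[of v "\<sigma> v" n] pos[OF assms(2)] by (simp add: st)
  then have "ht v n = s + t" using assms(2) by (simp add: ht_linear)
  then have mx: "ht v' n \<le> ht v n" if "v' \<in> V" for v' using cone_max[OF assms(2) st0 that] nst by simp
  then have "n \<in> \<Delta> \<inter> N" using le1 by (force simp: hull_eq n_def)
  then have hn1: "ht v n = 1" using assms(1) n0 kappa_eq[OF assms(2) mx] by force
  show ?thesis
    unfolding dual_lattice_def
  proof safe
    fix z
    have z: "lat b1 b2 z = of_int (idet z u) *\<^sub>R v + of_int (idet (co v) z) *\<^sub>R n"
    proof -
      have "lat b1 b2 z = of_int (idet z u) *\<^sub>R lat b1 b2 (co v) + of_int (idet (co v) z) *\<^sub>R n"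
        by (subst idet_basis[OF u, of z]) (simp add: lat_def n_def algebra_simps)
      then show ?thesis using co assms(2) by simp
    qed
    have "dv v \<bullet> lat b1 b2 z = - (of_int (idet z u) + of_int (idet (co v) z))"
      unfolding dv_inner z ht_linear using hn1 assms(2) by simp
    then show "dv v \<bullet> lat b1 b2 z \<in> \<int>" by simp
  qed
qed

text \<open>The height of \<open>n\<close> is an integer that is positive and at most 1.\<close>

lemma kappa_integral:
  assumes "\<And>v. v \<in> V \<Longrightarrow> dv v \<in> dual_lattice N" "n \<in> \<Delta> \<inter> N" "n \<noteq> 0"
  shows "kappa \<Delta> n = -1"
proof -
  obtain v where v: "v \<in> V" "\<And>v'. v' \<in> V \<Longrightarrow> ht v' n \<le> ht v n" using ht_max[of n] by blast
  obtain s t where st: "0 \<le> s" "0 \<le> t" "n = s *\<^sub>R v + t *\<^sub>R \<sigma> v" "ht v n = s + t"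
    using cone_coords[OF v] by metis
  have "s + t \<noteq> 0" using st assms(3) by (auto simp: add_nonneg_eq_0_iff)
  then have "0 < ht v n" using st by simp
  moreover have "ht v n \<le> 1" using assms(2) v(1) by (auto simp: hull_eq)
  moreover have "dv v \<bullet> n \<in> \<int>" using assms(1)[OF v(1)] assms(2) by (auto simp: dual_lattice_def)
  then have "ht v n \<in> \<int>" by (simp add: dv_inner)
  ultimately have "ht v n = 1" by (auto elim!: Ints_cases)
  then show ?thesis using kappa_eq[OF v] by simp
qed

lemma reflexive_iff:
  assumes "lattice_polygon N \<Delta>" "0 \<in> interior \<Delta>"
  shows "reflexive_polygon N \<Delta> \<longleftrightarrow> (\<forall>n\<in>\<Delta> \<inter> N. n \<noteq> 0 \<longrightarrow> kappa \<Delta> n = -1)"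
proof
  assume "reflexive_polygon N \<Delta>"
  then have "vertices (dual_polygon \<Delta>) \<subseteq> dual_lattice N"
    by (simp add: reflexive_polygon_def lattice_polygon_def)
  then show "\<forall>n\<in>\<Delta> \<inter> N. n \<noteq> 0 \<longrightarrow> kappa \<Delta> n = -1"
    using dv_vertex kappa_integral by blast
next
  assume a: "\<forall>n\<in>\<Delta> \<inter> N. n \<noteq> 0 \<longrightarrow> kappa \<Delta> n = -1"
  have "vertices (dual_polygon \<Delta>) \<subseteq> dv ` V"
    unfolding vertices_def dual_eq_hull using extreme_point_of_convex_hull by blast
  then have "vertices (dual_polygon \<Delta>) \<subseteq> dual_lattice N"
    using dual_vertex_integral[OF a] by blast
  then show "reflexive_polygon N \<Delta>"
    using assms dual_is_polygon by (simp add: reflexive_polygon_def lattice_polygon_def)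
qed

end

theorem theorem3p1:
  fixes N \<Delta> :: "(real^2) set"
  assumes "rank2_lattice N"
    and "LDP_polygon N \<Delta>"
  shows "12 * (\<Sum>n\<in>\<Delta> \<inter> N. (kappa \<Delta> n + 1)\<^sup>2)
           = normalized_volume N \<Delta> + normalized_volume (dual_lattice N) (dual_polygon \<Delta>)
    \<and> normalized_volume N \<Delta> + normalized_volume (dual_lattice N) (dual_polygon \<Delta>) \<ge> 12
    \<and> (normalized_volume N \<Delta> + normalized_volume (dual_lattice N) (dual_polygon \<Delta>) = 12
        \<longleftrightarrow> reflexive_polygon N \<Delta>)"
proof -
  have lp: "lattice_polygon N \<Delta>" and int: "0 \<in> interior \<Delta>"
    and prim: "\<And>v. v \<in> vertices \<Delta> \<Longrightarrow> primitive_point N v"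
    using assms(2) by (auto simp: LDP_polygon_def)
  then have poly: "polytope \<Delta>" by (simp add: lattice_polygon_def polygon_def)
  obtain \<sigma> where cyc: "polygon_cycle (vertices \<Delta>) \<sigma>" and hull: "\<Delta> = convex hull (vertices \<Delta>)"
    using polygon_cycle_vertices[OF poly int] .
  obtain a b where N: "N = range (lat a b)" and D: "cross a b > 0" and gen: "\<And>v. v \<in> vertices \<Delta> \<Longrightarrow> cross a v \<noteq> 0"
    using generic_basis[OF assms(1), of "vertices \<Delta>"] polygon_cycle.finV[OF cyc] prim
    unfolding primitive_point_def by (metis subsetI)
  have "\<exists>z. lat a b z = v \<and> iprim z" if "v \<in> vertices \<Delta>" for v
    using primitive_point_lat[of a b v] D prim[OF that] N by (metis less_irrefl)
  then obtain co where co: "\<And>v. v \<in> vertices \<Delta> \<Longrightarrow> lat a b (co v) = v \<and> iprim (co v)" by metis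
  interpret ldp_cycle "vertices \<Delta>" \<sigma> a b co
    using cyc co D gen by (simp add: ldp_cycle_def ldp_cycle_axioms_def)
  note * = hull[symmetric] N[symmetric]
  show ?thesis
    using main_identity sum_ge_1 sum_eq_1_iff reflexive_iff lp int unfolding * by auto
qed

end
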